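(* If a set $\{\pi_1,\pi_2,\pi_3,\pi_4\}$ of four (distinct) $4$-point permutations is quasirandom-forcing, then either the matrix $A_{\pi_1}+A_{\pi_2}+A_{\pi_3}+A_{\pi_4}$ is the $4\times4$ all-one matrix or, possibly after relabeling the four permutations, the matrix $A_{\pi_1}+A_{\pi_2}-A_{\pi_3}-A_{\pi_4}$ is the zero matrix.
   Context: For a $k$-point permutation $\pi$ (a bijection of $[k]=\{1,\dots,k\}$), the permutation matrix $A_\pi$ is the $k\times k$ matrix whose entry in row $i$ and column $\pi(i)$ is $1$ for each $i\in[k]$, all other entries being $0$. Pattern density: for a $k$-point permutation $\sigma$ and an $n$-point permutation $\pi$, $d(\sigma,\pi)$ is the probability that a uniformly random $k$-subset $\{a_1<\dots<a_k\}$ of $[n]$ induces $\sigma$, i.e. $\pi(a_i)<\pi(a_j)\iff\sigma(i)<\sigma(j)$. A set $S$ of permutations is quasirandom-forcing if every sequence $(\pi_n)$ of permutations with sizes tending to infinity with $d(\sigma,\pi_n)\to1/|\sigma|!$ for all $\sigma\in S$ satisfies $d(\sigma,\pi_n)\to1/|\sigma|!$ for every permutation $\sigma$. *)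

theory Defs
  imports
    Complex_Main
    "HOL-Combinatorics.Permutations"
    "Jordan_Normal_Form.Matrix"
begin

text \<open>
  A \<open>k\<close>-point permutation is a function \<open>p\<close> with \<open>p permutes {1..k}\<close>. Such a function fixes every
  number outside \<open>{1..k}\<close> and so does not determine \<open>k\<close>; where permutations of different sizes
  occur together (sets of patterns), a permutation is represented by the pair \<open>(k, p)\<close>.
\<close>

definition perm_matrix :: "nat \<Rightarrow> (nat \<Rightarrow> nat) \<Rightarrow> int mat" where
  \<comment> \<open>matrix indices start at 0, points of a permutation at 1\<close>
  "perm_matrix k p = mat k k (\<lambda>(i, j). if p (Suc i) = Suc j then 1 else 0)"

definition all_one_matrix :: "nat \<Rightarrow> int mat" where
  "all_one_matrix k = mat k k (\<lambda>_. 1)"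

definition induces :: "(nat \<Rightarrow> nat) \<Rightarrow> nat set \<Rightarrow> (nat \<Rightarrow> nat) \<Rightarrow> bool" where
  "induces \<pi> A \<sigma> \<longleftrightarrow>
     (let a = (\<lambda>i. sorted_list_of_set A ! (i - 1)) in
      \<forall>i\<in>{1..card A}. \<forall>j\<in>{1..card A}. \<pi> (a i) < \<pi> (a j) \<longleftrightarrow> \<sigma> i < \<sigma> j)"

text \<open>
  The density of the \<open>k\<close>-point permutation \<open>\<sigma>\<close> in the \<open>n\<close>-point permutation \<open>\<pi>\<close>. For \<open>n < k\<close> there
  is no \<open>k\<close>-subset, and the value is 0.
\<close>

definition pattern_density :: "nat \<Rightarrow> (nat \<Rightarrow> nat) \<Rightarrow> nat \<Rightarrow> (nat \<Rightarrow> nat) \<Rightarrow> real" where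
  "pattern_density k \<sigma> n \<pi> =
     real (card {A. A \<subseteq> {1..n} \<and> card A = k \<and> induces \<pi> A \<sigma>}) /
     real (card {A. A \<subseteq> {1..n} \<and> card A = k})"

definition quasirandom_forcing :: "(nat \<times> (nat \<Rightarrow> nat)) set \<Rightarrow> bool" where
  "quasirandom_forcing S \<longleftrightarrow>
     (\<forall>(N :: nat \<Rightarrow> nat) (\<pi> :: nat \<Rightarrow> nat \<Rightarrow> nat).
        (\<forall>n. \<pi> n permutes {1..N n}) \<longrightarrow>
        filterlim N at_top sequentially \<longrightarrow>
        (\<forall>(k, \<sigma>)\<in>S. (\<lambda>n. pattern_density k \<sigma> (N n) (\<pi> n)) \<longlonglongrightarrow> 1 / fact k) \<longrightarrow>
        (\<forall>k \<sigma>. \<sigma> permutes {1..k} \<longrightarrow>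
           (\<lambda>n. pattern_density k \<sigma> (N n) (\<pi> n)) \<longlonglongrightarrow> 1 / fact k))"

end

theory Submission
  imports Defs "HOL-Analysis.Analysis" "HOL-Real_Asymp.Real_Asymp"
begin

text \<open>
  Perturb the uniform measure on the square by a density \<open>1 + \<Sum> t a b * u a x * u b y\<close>, where \<open>t\<close> is a
  \<open>4 \<times> 4\<close> matrix with zero row and column sums and \<open>u 1, \<dots>, u 4\<close> are dual to the distributions of
  the order statistics of four random points. To first order the density of \<open>\<sigma>\<close> changes by the
  inner product of \<open>t\<close> with the permutation matrix of \<open>\<sigma>\<close>, and the error is quadratic in \<open>t\<close>. If the
  four given matrices are linearly independent modulo the all-one matrix, then so are they together
  with some fifth permutation matrix, because the space of all \<open>t\<close> has dimension 9. Brouwer's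
  theorem then yields perturbations for which the four densities are exactly uniform while the
  fifth is not, so the four permutations are not quasirandom-forcing. Linear dependence modulo the
  all-one matrix, finally, occurs only in the two ways named in the theorem.

  Measures are avoided: the density is sampled on an \<open>m \<times> m\<close> grid, scaled to an integer matrix with
  equal row and column sums, and realised by a permutation with the prescribed number of points in
  each box. Tuples with two points in the same row or column of boxes contribute only \<open>O(1/m)\<close>.
\<close>

section \<open>Increasing maps and order statistics\<close>

text \<open>An increasing map enumerates a \<open>k\<close>-subset by its order statistics.
  Extensionality on \<open>{1..k}\<close> makes the map unique for its image.\<close>

definition inc_maps :: "nat \<Rightarrow> nat set \<Rightarrow> (nat \<Rightarrow> nat) set" where
  "inc_maps k X = {f \<in> {1..k} \<rightarrow>\<^sub>E X. strict_mono_on {1..k} f}"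

lemma inc_mapsD:
  assumes "f \<in> inc_maps k X"
  shows "f \<in> {1..k} \<rightarrow>\<^sub>E X" "\<And>i. i \<in> {1..k} \<Longrightarrow> f i \<in> X" "strict_mono_on {1..k} f" "inj_on f {1..k}"
  using assms by (auto simp: inc_maps_def strict_mono_on_imp_inj_on)

lemma inc_maps_less_iff:
  assumes "f \<in> inc_maps k X" "i \<in> {1..k}" "j \<in> {1..k}"
  shows "f i < f j \<longleftrightarrow> i < j"
  using strict_mono_on_less[OF inc_mapsD(3)[OF assms(1)] assms(2,3)] .

lemma finite_inc_maps [simp]: "finite X \<Longrightarrow> finite (inc_maps k X)"
  unfolding inc_maps_def by (rule finite_subset[of _ "{1..k} \<rightarrow>\<^sub>E X"]) (auto intro: finite_PiE)

lemma sorted_list_of_image_inc_map: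
  assumes f: "f \<in> inc_maps k X"
  shows "sorted_list_of_set (f ` {1..k}) = map f [1..<Suc k]"
proof (rule sorted_distinct_set_unique)
  have "sorted_wrt (<) (map f [1..<Suc k])"
    unfolding sorted_wrt_map
    by (rule sorted_wrt_mono_rel[OF _ sorted_wrt_upt])
      (use inc_maps_less_iff[OF f] in auto)
  then show "sorted (map f [1..<Suc k])" "distinct (map f [1..<Suc k])"
    by (auto simp: strict_sorted_iff)
  show "set (sorted_list_of_set (f ` {1..k})) = set (map f [1..<Suc k])"
    by (auto simp: atLeastLessThanSuc_atLeastAtMost)
qed auto

lemma nth_sorted_list_of_image_inc_map:
  assumes "f \<in> inc_maps k X" "i \<in> {1..k}"
  shows "sorted_list_of_set (f ` {1..k}) ! (i - 1) = f i"
  using assms(2) unfolding sorted_list_of_image_inc_map[OF assms(1)]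
  by (subst nth_map) (auto simp del: upt_Suc)

lemma bij_betw_inc_maps_subsets:
  assumes "finite X"
  shows "bij_betw (\<lambda>f. f ` {1..k}) (inc_maps k X) {A. A \<subseteq> X \<and> card A = k}"
  unfolding bij_betw_def
proof
  show "inj_on (\<lambda>f. f ` {1..k}) (inc_maps k X)"
  proof (rule inj_onI)
    fix f g assume f: "f \<in> inc_maps k X" and g: "g \<in> inc_maps k X" and e: "f ` {1..k} = g ` {1..k}"
    show "f = g"
    proof (rule PiE_ext[OF inc_mapsD(1)[OF f] inc_mapsD(1)[OF g]])
      fix i assume "i \<in> {1..k}"
      then show "f i = g i"
        using nth_sorted_list_of_image_inc_map[OF f] nth_sorted_list_of_image_inc_map[OF g] e by metis
    qed
  qed
  show "(\<lambda>f. f ` {1..k}) ` inc_maps k X = {A. A \<subseteq> X \<and> card A = k}"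
  proof (intro equalityI subsetI)
    fix A assume "A \<in> (\<lambda>f. f ` {1..k}) ` inc_maps k X"
    then obtain f where f: "f \<in> inc_maps k X" "A = f ` {1..k}" by auto
    then show "A \<in> {A. A \<subseteq> X \<and> card A = k}"
      using inc_mapsD[OF f(1)] by (auto simp: card_image)
  next
    fix A assume "A \<in> {A. A \<subseteq> X \<and> card A = k}"
    then have A: "A \<subseteq> X" "card A = k" "finite A" using assms finite_subset by auto
    define xs where "xs = sorted_list_of_set A"
    have xs: "length xs = k" "set xs = A" "sorted_wrt (<) xs"
      using A by (auto simp: xs_def)
    define f where "f = (\<lambda>i\<in>{1..k}. xs ! (i - 1))"
    have im: "f ` {1..k} = A"
    proof -
      have "f ` {1..k} = (\<lambda>i. xs ! i) ` ((\<lambda>i. i - 1) ` {1..k})"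
        by (auto simp: f_def image_image)
      also have "(\<lambda>i. i - 1) ` {1..k} = {..<k}"
        by (force simp: image_iff intro: bexI[of _ "Suc _"])
      also have "(\<lambda>i. xs ! i) ` {..<k} = A"
        using xs by (auto simp: set_conv_nth)
      finally show ?thesis .
    qed
    have "strict_mono_on {1..k} f"
      using xs by (auto simp: f_def intro!: strict_mono_onI sorted_wrt_nth_less[of "(<)"])
    moreover have "f \<in> {1..k} \<rightarrow>\<^sub>E X" using im A by (auto simp: f_def)
    ultimately show "A \<in> (\<lambda>f. f ` {1..k}) ` inc_maps k X"
      using im by (auto simp: inc_maps_def)
  qed
qed

lemma card_inc_maps: "finite X \<Longrightarrow> card (inc_maps k X) = card X choose k"
  using bij_betw_same_card[OF bij_betw_inc_maps_subsets] n_subsets by metis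

text \<open>Occurrences as increasing maps instead of subsets: the \<open>i\<close>-th smallest
  chosen point is \<open>f i\<close>, without the sorted list used in
  \<open>induces\<close>.\<close>

definition occurrences :: "nat \<Rightarrow> (nat \<Rightarrow> nat) \<Rightarrow> nat \<Rightarrow> (nat \<Rightarrow> nat) \<Rightarrow> (nat \<Rightarrow> nat) set" where
  "occurrences k \<sigma> n \<pi> = {f \<in> inc_maps k {1..n}. \<forall>i\<in>{1..k}. \<forall>j\<in>{1..k}. \<pi> (f i) < \<pi> (f j) \<longleftrightarrow> \<sigma> i < \<sigma> j}"

lemma pattern_density_eq_occurrences:
  "pattern_density k \<sigma> n \<pi> = real (card (occurrences k \<sigma> n \<pi>)) / real (n choose k)"
proof -
  let ?b = "\<lambda>f. f ` {1..k::nat}"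
  note bij = bij_betw_inc_maps_subsets[of "{1..n}" k, simplified]
  have ind: "induces \<pi> (?b f) \<sigma> \<longleftrightarrow> (\<forall>i\<in>{1..k}. \<forall>j\<in>{1..k}. \<pi> (f i) < \<pi> (f j) \<longleftrightarrow> \<sigma> i < \<sigma> j)"
    if f: "f \<in> inc_maps k {1..n}" for f
    using inc_mapsD(4)[OF f] nth_sorted_list_of_image_inc_map[OF f]
    by (simp add: induces_def Let_def card_image)
  have "bij_betw ?b (occurrences k \<sigma> n \<pi>) {A. A \<subseteq> {1..n} \<and> card A = k \<and> induces \<pi> A \<sigma>}"
  proof (rule bij_betw_subset[OF bij_betw_inc_maps_subsets[of "{1..n}" k]])
    show "occurrences k \<sigma> n \<pi> \<subseteq> inc_maps k {1..n}" by (auto simp: occurrences_def)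
    show "?b ` occurrences k \<sigma> n \<pi> = {A. A \<subseteq> {1..n} \<and> card A = k \<and> induces \<pi> A \<sigma>}"
    proof (intro equalityI subsetI)
      fix A assume "A \<in> ?b ` occurrences k \<sigma> n \<pi>"
      then obtain f where f: "f \<in> inc_maps k {1..n}" "A = ?b f" "induces \<pi> (?b f) \<sigma>"
        using ind by (auto simp: occurrences_def)
      moreover have "A \<in> {A. A \<subseteq> {1..n} \<and> card A = k}"
        using f bij_betw_apply[OF bij] by auto
      ultimately show "A \<in> {A. A \<subseteq> {1..n} \<and> card A = k \<and> induces \<pi> A \<sigma>}" by auto
    next
      fix A assume A: "A \<in> {A. A \<subseteq> {1..n} \<and> card A = k \<and> induces \<pi> A \<sigma>}"
      then have "A \<in> ?b ` inc_maps k {1..n}"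
        using bij_betw_imp_surj_on[OF bij_betw_inc_maps_subsets[of "{1..n}" k]] by auto
      then obtain f where "f \<in> inc_maps k {1..n}" "A = ?b f" by auto
      with A ind show "A \<in> ?b ` occurrences k \<sigma> n \<pi>" by (auto simp: occurrences_def)
    qed
  qed auto
  then show ?thesis
    unfolding pattern_density_def using n_subsets[of "{1..n}" k] by (simp add: bij_betw_same_card)
qed

section \<open>Moments of order statistics\<close>

text \<open>Pascal's rule for maps: the largest value \<open>m\<close> is either missed or, by
  monotonicity, taken at the last argument, and removing it leaves a map with one argument
  fewer.\<close>

lemma inc_maps_Suc_lessThan_Suc:
  "inc_maps (Suc s) {..<Suc m} =
     inc_maps (Suc s) {..<m} \<union> (\<lambda>f. f(Suc s := m)) ` inc_maps s {..<m}" (is "?L = ?R1 \<union> ?R2")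
proof (intro equalityI subsetI)
  fix f assume f: "f \<in> ?L"
  show "f \<in> ?R1 \<union> ?R2"
  proof (cases "f (Suc s) < m")
    case True
    have "f i < m" if "i \<in> {1..Suc s}" for i
      using inc_maps_less_iff[OF f that, of "Suc s"] that True by (cases "i = Suc s") auto
    then show ?thesis using f by (auto simp: inc_maps_def PiE_iff)
  next
    case False
    then have fm: "f (Suc s) = m" using inc_mapsD(2)[OF f, of "Suc s"] by auto
    define g where "g = restrict f {1..s}"
    have "f i < m" if "i \<in> {1..s}" for i
      using inc_maps_less_iff[OF f, of i "Suc s"] that fm by auto
    then have "g \<in> inc_maps s {..<m}"
      using inc_maps_less_iff[OF f]
      by (auto simp: inc_maps_def g_def intro!: strict_mono_onI)
    moreover have "f = g(Suc s := m)"
      using inc_mapsD(1)[OF f] fm by (auto simp: g_def fun_eq_iff PiE_def extensional_def)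
    ultimately show ?thesis by blast
  qed
next
  fix f assume "f \<in> ?R1 \<union> ?R2"
  then show "f \<in> ?L"
  proof
    assume "f \<in> ?R1"
    then show ?thesis by (force simp: inc_maps_def PiE_iff)
  next
    assume "f \<in> ?R2"
    then obtain g where g: "g \<in> inc_maps s {..<m}" and f: "f = g(Suc s := m)" by auto
    have lt: "g i < m" if "i \<in> {1..s}" for i using inc_mapsD(2)[OF g that] by auto
    have "f \<in> {1..Suc s} \<rightarrow>\<^sub>E {..<Suc m}"
      using inc_mapsD(1)[OF g] lt by (auto simp: f PiE_def extensional_def less_Suc_eq)
    moreover have "strict_mono_on {1..Suc s} f"
      using inc_maps_less_iff[OF g] lt by (auto simp: f intro!: strict_mono_onI)
    ultimately show ?thesis by (auto simp: inc_maps_def)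
  qed
qed

lemma sum_inc_maps_Suc:
  fixes g :: "(nat \<Rightarrow> nat) \<Rightarrow> real"
  shows "(\<Sum>f\<in>inc_maps (Suc s) {..<Suc m}. g f) =
    (\<Sum>f\<in>inc_maps (Suc s) {..<m}. g f) + (\<Sum>f\<in>inc_maps s {..<m}. g (f(Suc s := m)))"
proof -
  have "inc_maps (Suc s) {..<m} \<inter> (\<lambda>f. f(Suc s := m)) ` inc_maps s {..<m} = {}"
    using inc_mapsD(2)[of _ "Suc s" "{..<m}" "Suc s"] by fastforce
  moreover have "inj_on (\<lambda>f. f(Suc s := m)) (inc_maps s {..<m})"
  proof (rule inj_onI)
    fix f g assume f: "f \<in> inc_maps s {..<m}" and g: "g \<in> inc_maps s {..<m}"
      and e: "f(Suc s := m) = g(Suc s := m)"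
    show "f = g"
    proof (rule PiE_ext[OF inc_mapsD(1)[OF f] inc_mapsD(1)[OF g]])
      show "f i = g i" if "i \<in> {1..s}" for i
        using fun_cong[OF e, of i] that by auto
    qed
  qed
  ultimately show ?thesis
    unfolding inc_maps_Suc_lessThan_Suc by (subst sum.union_disjoint) (auto simp: sum.reindex)
qed

text \<open>Both sides equal \<open>(m + r)! / (s! (m - s)!)\<close> if \<open>s \<le> m\<close> and
  vanish otherwise. The identity later extracts the factor \<open>m choose s\<close> from the
  moments.\<close>

lemma pochhammer_mult_binomial:
  "pochhammer (real m + 1) r * real (m choose s) = pochhammer (real s + 1) r * real ((m + r) choose (s + r))"
proof (induction r)
  case (Suc r)
  have *: "real (Suc (s + r)) * real (Suc (m + r) choose Suc (s + r)) = real (Suc (m + r)) * real ((m + r) choose (s + r))"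
    using Suc_times_binomial_eq[of "m + r" "s + r"] by (metis of_nat_mult mult.commute)
  have "pochhammer (real m + 1) (Suc r) * real (m choose s)
      = real (Suc (m + r)) * (pochhammer (real m + 1) r * real (m choose s))"
    by (simp add: pochhammer_Suc algebra_simps)
  also have "\<dots> = pochhammer (real s + 1) r * (real (Suc (m + r)) * real ((m + r) choose (s + r)))"
    using Suc by simp
  also have "\<dots> = pochhammer (real s + 1) (Suc r) * real ((m + Suc r) choose (s + Suc r))"
    unfolding *[symmetric] by (simp add: pochhammer_Suc algebra_simps)
  finally show ?case .
qed simp

text \<open>Rising factorials make the moments of order statistics exact at every \<open>m\<close>.\<close>

lemma sum_inc_maps_pochhammer:
  assumes "1 \<le> k" "k \<le> s"
  shows "(\<Sum>f\<in>inc_maps s {..<m}. pochhammer (real (f k) + 1) r)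
         = pochhammer (real k) r * real ((m + r) choose (s + r))"
  using assms
proof (induction m arbitrary: s)
  case 0
  then have "inc_maps s {..<0} = {}" using inc_mapsD(2)[of _ s "{..<0}" k] by auto
  with 0 show ?case by simp
next
  case (Suc m)
  then obtain s' where s: "s = Suc s'" by (cases s) auto
  have 1: "(\<Sum>f\<in>inc_maps s {..<m}. pochhammer (real (f k) + 1) r)
         = pochhammer (real k) r * real ((m + r) choose (s + r))" using Suc by simp
  \<comment> \<open>For \<open>k = s\<close> the value at \<open>k\<close> is the constant
    \<open>m\<close> and the sum just counts maps; for \<open>k < s\<close> the update leaves
    \<open>f k\<close> alone and the induction hypothesis for \<open>s'\<close> applies.\<close>
  have 2: "(\<Sum>f\<in>inc_maps s' {..<m}. pochhammer (real ((f(s := m)) k) + 1) r)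
         = pochhammer (real k) r * real ((m + r) choose (s' + r))"
  proof (cases "k = s")
    case True
    then show ?thesis
      using pochhammer_mult_binomial[of m r s'] by (simp add: s card_inc_maps algebra_simps)
  next
    case False
    then show ?thesis using Suc.IH[of s'] Suc.prems s by auto
  qed
  show ?case using 1 2 unfolding s sum_inc_maps_Suc by (simp add: algebra_simps)
qed

lemma sum_inc_maps_one:
  fixes g :: "nat \<Rightarrow> real"
  shows "(\<Sum>f\<in>inc_maps 1 {..<m}. g (f 1)) = (\<Sum>i<m. g i)"
proof (induction m)
  case 0
  have "inc_maps 1 {..<0} = {}" using inc_mapsD(2)[of _ 1 "{..<0}" 1] by auto
  then show ?case by simp
next
  case (Suc m)
  have "inc_maps 0 {..<m} = {\<lambda>_. undefined}" by (auto simp: inc_maps_def intro: strict_mono_onI)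
  then show ?case using Suc sum_inc_maps_Suc[of "\<lambda>f. g (f 1)" 0 m] by simp
qed

section \<open>Permutations with prescribed box counts\<close>

text \<open>Points are numbered from 1 and strips from 0, hence the shift in \<open>x - 1\<close>:
  strip \<open>i\<close> consists of the \<open>S\<close> consecutive points after
  \<open>i * S\<close>.\<close>

lemma div_strip_eq:
  assumes "S > (0::nat)" "x > 0"
  shows "(x - 1) div S = i \<longleftrightarrow> x \<in> {i * S + 1..i * S + S}"
proof -
  obtain y where "x = Suc y" using assms(2) by (cases x) auto
  moreover have "S * (y div S) \<le> y" "y < S * (y div S) + S"
    using assms(1) dividend_less_times_div by (auto simp: add.commute)
  ultimately show ?thesis using assms(1)
    by (auto simp: mult.commute[of i] mult.commute[of _ S] intro: div_nat_eqI)
qed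

text \<open>Each fibre of \<open>h\<close> has as many elements as a strip of \<open>S\<close>
  consecutive numbers; bijections chosen strip by strip glue together because different strips go to
  different fibres.\<close>

lemma fibrewise_enumeration:
  fixes h :: "'a \<Rightarrow> nat"
  assumes fin: "finite Q" and h: "\<And>q. q \<in> Q \<Longrightarrow> h q < m" and S: "S > 0"
    and fib: "\<And>i. i < m \<Longrightarrow> card {q \<in> Q. h q = i} = S"
  shows "\<exists>f. bij_betw f {1..m * S} Q \<and> (\<forall>x\<in>{1..m * S}. h (f x) = (x - 1) div S)"
proof -
  define strip where "strip = (\<lambda>i. {x \<in> {1..m * S}. (x - 1) div S = i})"
  have card_strip: "card (strip i) = S" if "i < m" for i
  proof -
    have "strip i = {i * S + 1..i * S + S}"
    proof -
      have "Suc i * S \<le> m * S" using that by (intro mult_right_mono) auto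
      then have "x \<in> strip i \<longleftrightarrow> x \<in> {i * S + 1..i * S + S}" for x
        using div_strip_eq[OF S, of x i] by (cases x) (auto simp: strip_def)
      then show ?thesis by blast
    qed
    then show ?thesis by simp
  qed
  have "\<exists>e. bij_betw e (strip i) {q \<in> Q. h q = i}" if "i < m" for i
    using that fin fib[OF that] card_strip[OF that]
    by (intro finite_same_card_bij) (auto simp: strip_def)
  then obtain e where e: "\<And>i. i < m \<Longrightarrow> bij_betw (e i) (strip i) {q \<in> Q. h q = i}" by metis
  define f where "f = (\<lambda>x. e ((x - 1) div S) x)"
  have row: "(x - 1) div S < m" if "x \<in> {1..m * S}" for x
    using that S by (intro less_mult_imp_div_less) auto
  have hf: "f x \<in> Q \<and> h (f x) = (x - 1) div S" if "x \<in> {1..m * S}" for x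
    using bij_betw_apply[OF e[OF row[OF that]], of x] that by (auto simp: f_def strip_def)
  have inj: "inj_on f {1..m * S}"
  proof (rule inj_onI)
    fix x y assume xy: "x \<in> {1..m * S}" "y \<in> {1..m * S}" "f x = f y"
    then have "(x - 1) div S = (y - 1) div S" using hf by metis
    with xy show "x = y"
      using bij_betw_imp_inj_on[OF e[OF row[OF xy(1)]]] by (auto simp: f_def strip_def dest: inj_onD)
  qed
  have "f ` {1..m * S} = Q"
  proof (intro equalityI subsetI)
    fix q assume q: "q \<in> Q"
    then obtain x where "x \<in> strip (h q)" "q = e (h q) x"
      using bij_betw_imp_surj_on[OF e[OF h[OF q]]] by blast
    then show "q \<in> f ` {1..m * S}" by (intro image_eqI[of _ _ x]) (simp_all add: f_def strip_def)
  qed (use hf in auto)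
  with inj hf show ?thesis by (auto simp: bij_betw_def)
qed

text \<open>\<open>Q\<close> holds \<open>K i j\<close> labelled points for box
  \<open>(i, j)\<close>. It is enumerated once row by row, by \<open>f\<close>, and once column by
  column, by \<open>g\<close>; the permutation takes the position of a point in the first
  enumeration to its position in the second.\<close>

lemma ex_permutation_with_box_counts:
  fixes K :: "nat \<Rightarrow> nat \<Rightarrow> nat"
  assumes rows: "\<And>i. i < m \<Longrightarrow> (\<Sum>j<m. K i j) = S" and cols: "\<And>j. j < m \<Longrightarrow> (\<Sum>i<m. K i j) = S"
    and S: "S > 0"
  shows "\<exists>\<pi>. \<pi> permutes {1..m * S} \<and>
    (\<forall>i<m. \<forall>j<m. card {x \<in> {1..m * S}. (x - 1) div S = i \<and> (\<pi> x - 1) div S = j} = K i j)"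
proof -
  define Q where "Q = (SIGMA i:{..<m}. SIGMA j:{..<m}. {..<K i j})"
  have fin: "finite Q" by (simp add: Q_def)
  have Q_fst: "fst q < m" and Q_snd: "fst (snd q) < m" if "q \<in> Q" for q
    using that by (auto simp: Q_def)
  have "card {q \<in> Q. fst q = i} = S" if "i < m" for i
  proof -
    have "{q \<in> Q. fst q = i} = {i} \<times> (SIGMA j:{..<m}. {..<K i j})" using that by (auto simp: Q_def)
    then show ?thesis using rows[OF that] by (simp add: card_cartesian_product)
  qed
  then obtain f where
    f: "bij_betw f {1..m * S} Q" "\<And>x. x \<in> {1..m * S} \<Longrightarrow> fst (f x) = (x - 1) div S"
    using fibrewise_enumeration[of Q fst m S] fin Q_fst S by blast
  have "card {q \<in> Q. fst (snd q) = j} = S" if "j < m" for j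
  proof -
    have "bij_betw (\<lambda>(i, k). (i, j, k)) (SIGMA i:{..<m}. {..<K i j}) {q \<in> Q. fst (snd q) = j}"
      using that by (auto simp: Q_def bij_betw_def inj_on_def image_def)
    from bij_betw_same_card[OF this] show ?thesis using cols[OF that] by simp
  qed
  then obtain g where
    g: "bij_betw g {1..m * S} Q" "\<And>x. x \<in> {1..m * S} \<Longrightarrow> fst (snd (g x)) = (x - 1) div S"
    using fibrewise_enumeration[of Q "\<lambda>q. fst (snd q)" m S] fin Q_snd S by blast
  define \<pi>' where "\<pi>' = inv_into {1..m * S} g \<circ> f"
  define \<pi> where "\<pi> = (\<lambda>x. if x \<in> {1..m * S} then \<pi>' x else x)"
  have bij: "bij_betw \<pi>' {1..m * S} {1..m * S}"
    unfolding \<pi>'_def using f(1) bij_betw_inv_into[OF g(1)] by (rule bij_betw_trans)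
  then have "bij_betw \<pi> {1..m * S} {1..m * S}"
    by (rule bij_betw_cong[THEN iffD1, rotated]) (auto simp: \<pi>_def)
  then have "\<pi> permutes {1..m * S}" by (intro bij_imp_permutes) (auto simp: \<pi>_def)
  moreover have "card {x \<in> {1..m * S}. (x - 1) div S = i \<and> (\<pi> x - 1) div S = j} = K i j"
    if "i < m" "j < m" for i j
  proof -
    have col: "(\<pi> x - 1) div S = fst (snd (f x))" if "x \<in> {1..m * S}" for x
    proof -
      have "g (\<pi> x) = f x"
        using that f(1) g(1) by (auto simp: \<pi>_def \<pi>'_def bij_betw_inv_into_right bij_betw_apply)
      moreover have "\<pi> x \<in> {1..m * S}" using bij_betw_apply[OF bij that] that by (simp add: \<pi>_def)
      ultimately show ?thesis using g(2) by metis
    qed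
    have "bij_betw f {x \<in> {1..m * S}. (x - 1) div S = i \<and> (\<pi> x - 1) div S = j}
        {q \<in> Q. fst q = i \<and> fst (snd q) = j}"
    proof (rule bij_betw_subset[OF f(1)])
      show "f ` {x \<in> {1..m * S}. (x - 1) div S = i \<and> (\<pi> x - 1) div S = j} =
          {q \<in> Q. fst q = i \<and> fst (snd q) = j}" (is "?l = ?r")
      proof (intro equalityI subsetI)
        fix q assume "q \<in> ?l"
        then obtain x where "x \<in> {1..m * S}" "(x - 1) div S = i" "(\<pi> x - 1) div S = j" "q = f x" by blast
        then show "q \<in> ?r" using col[of x] f(2)[of x] bij_betw_apply[OF f(1), of x] by simp
      next
        fix q assume q: "q \<in> ?r"
        then obtain x where "x \<in> {1..m * S}" "q = f x"
          using bij_betw_imp_surj_on[OF f(1)] by blast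
        with q show "q \<in> ?l" using col[of x] f(2)[of x] by (intro image_eqI[of _ _ x]) simp_all
      qed
    qed auto
    moreover have "{q \<in> Q. fst q = i \<and> fst (snd q) = j} = {i} \<times> {j} \<times> {..<K i j}"
      using that by (auto simp: Q_def)
    ultimately show ?thesis by (simp add: bij_betw_same_card card_cartesian_product)
  qed
  ultimately show ?thesis by blast
qed

section \<open>Counting occurrences by boxes\<close>

text \<open>Once \<open>f a\<close> is chosen freely, \<open>f b\<close> lies in a fibre of at most
  \<open>S\<close> elements and the other \<open>k - 2\<close> values are free.\<close>

lemma card_PiE_collision_le:
  fixes h :: "nat \<Rightarrow> nat"
  assumes X: "finite X" and ab: "a \<in> {1..k}" "b \<in> {1..k}" "a \<noteq> b"
    and fib: "\<And>x. x \<in> X \<Longrightarrow> card {y \<in> X. h y = h x} \<le> S"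
  shows "card {f \<in> {1..k} \<rightarrow>\<^sub>E X. h (f a) = h (f b)} \<le> card X ^ (k - 1) * S"
proof -
  define T where "T = (\<lambda>x i. if i = a then {x} else if i = b then {y \<in> X. h y = h x} else X)"
  have "{f \<in> {1..k} \<rightarrow>\<^sub>E X. h (f a) = h (f b)} \<subseteq> (\<Union>x\<in>X. \<Pi>\<^sub>E i\<in>{1..k}. T x i)"
  proof
    fix f assume f: "f \<in> {f \<in> {1..k} \<rightarrow>\<^sub>E X. h (f a) = h (f b)}"
    then have "f a \<in> X" "f \<in> (\<Pi>\<^sub>E i\<in>{1..k}. T (f a) i)" using ab by (auto simp: T_def PiE_iff)
    then show "f \<in> (\<Union>x\<in>X. \<Pi>\<^sub>E i\<in>{1..k}. T x i)" by blast
  qed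
  then have "card {f \<in> {1..k} \<rightarrow>\<^sub>E X. h (f a) = h (f b)} \<le> card (\<Union>x\<in>X. \<Pi>\<^sub>E i\<in>{1..k}. T x i)"
    using X by (intro card_mono) (auto intro!: finite_PiE simp: T_def)
  also have "\<dots> \<le> (\<Sum>x\<in>X. card (\<Pi>\<^sub>E i\<in>{1..k}. T x i))" by (rule card_UN_le[OF X])
  also have "\<dots> \<le> (\<Sum>x\<in>X. card X ^ (k - 2) * S)"
  proof (rule sum_mono)
    fix x assume x: "x \<in> X"
    have "card (\<Pi>\<^sub>E i\<in>{1..k}. T x i) = (\<Prod>i\<in>{1..k}. card (T x i))" by (rule card_PiE) simp
    also have "\<dots> = card (T x a) * (card (T x b) * (\<Prod>i\<in>{1..k} - {a} - {b}. card (T x i)))"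
      using ab prod.remove[of "{1..k}" a "\<lambda>i. card (T x i)"]
        prod.remove[of "{1..k} - {a}" b "\<lambda>i. card (T x i)"] by simp
    also have "(\<Prod>i\<in>{1..k} - {a} - {b}. card (T x i)) = (\<Prod>i\<in>{1..k} - {a} - {b}. card X)"
      by (rule prod.cong) (auto simp: T_def)
    also have "\<dots> = card X ^ (k - 2)" using ab by (simp add: card_Diff_singleton numeral_2_eq_2)
    also have "card (T x a) * (card (T x b) * card X ^ (k - 2)) \<le> card X ^ (k - 2) * S"
      using fib[OF x] ab by (simp add: T_def)
    finally show "card (\<Pi>\<^sub>E i\<in>{1..k}. T x i) \<le> card X ^ (k - 2) * S" .
  qed
  also have "\<dots> = card X ^ (Suc (k - 2)) * S" by simp
  also have "Suc (k - 2) = k - 1" using ab by auto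
  finally show ?thesis .
qed

text \<open>Occurrences whose points lie in distinct rows and distinct columns of the \<open>m \<times> m\<close> grid of
  boxes are counted exactly by the box counts; the others are a fraction \<open>O(1/m)\<close> of all tuples,
  whatever the arrangement inside the boxes.\<close>

lemma card_occurrences_box_counts:
  fixes K :: "nat \<Rightarrow> nat \<Rightarrow> nat"
  assumes S: "S > 0" and \<pi>: "\<pi> permutes {1..m * S}" and \<sigma>: "\<sigma> permutes {1..k}"
    and K: "\<And>i j. i < m \<Longrightarrow> j < m \<Longrightarrow>
      card {x \<in> {1..m * S}. (x - 1) div S = i \<and> (\<pi> x - 1) div S = j} = K i j"
  defines "M \<equiv> \<Sum>I\<in>inc_maps k {..<m}. \<Sum>J\<in>inc_maps k {..<m}. \<Prod>a\<in>{1..k}. K (I a) (J (\<sigma> a))"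
  shows "M \<le> card (occurrences k \<sigma> (m * S) \<pi>)"
    and "card (occurrences k \<sigma> (m * S) \<pi>) \<le> M + 2 * k\<^sup>2 * ((m * S) ^ (k - 1) * S)"
proof -
  define N where "N = m * S"
  define row where "row = (\<lambda>x::nat. (x - 1) div S)"
  define col where "col = (\<lambda>x. row (\<pi> x))"
  \<comment> \<open>Generic occurrences: no two of the points share a row or a column of
    boxes.\<close>
  define G where "G = {f \<in> occurrences k \<sigma> N \<pi>. inj_on (row \<circ> f) {1..k} \<and> inj_on (col \<circ> f) {1..k}}"
  define cell where "cell = (\<lambda>i j. {x \<in> {1..N}. row x = i \<and> col x = j})"
  \<comment> \<open>\<open>P (I, J)\<close> picks one point from each of the boxes
    \<open>(I a, J (\<sigma> a))\<close>, which are arranged in the pattern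
    \<open>\<sigma>\<close>.\<close>
  define P where "P = (\<lambda>(I, J). \<Pi>\<^sub>E a\<in>{1..k}. cell (I a) (J (\<sigma> a)))"
  have row_mono: "row x \<le> row y" if "x \<le> y" for x y
    using that by (auto simp: row_def intro: div_le_mono)
  have row_less: "x < y" if "row x < row y" for x y
    using that row_mono[of y x] by linarith
  have row_lt: "row x < m" if "x \<in> {1..N}" for x
    using that S by (auto simp: row_def N_def intro!: less_mult_imp_div_less)
  have \<pi>_in: "\<pi> x \<in> {1..N}" if "x \<in> {1..N}" for x
    using permutes_in_image[OF \<pi>] that by (simp add: N_def)
  have \<sigma>_in: "\<sigma> a \<in> {1..k}" if "a \<in> {1..k}" for a
    using permutes_in_image[OF \<sigma>] that by simp
  define \<iota> where "\<iota> = inv_into UNIV \<sigma>"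
  have \<sigma>i_in: "\<iota> a \<in> {1..k}" if "a \<in> {1..k}" for a
    using permutes_in_image[OF permutes_inv[OF \<sigma>]] that by (simp add: \<iota>_def)
  have \<sigma>i: "\<iota> (\<sigma> a) = a" "\<sigma> (\<iota> a) = a" for a using permutes_inverses[OF \<sigma>] by (auto simp: \<iota>_def)
  \<comment> \<open>A generic occurrence determines its increasing sequences of rows and columns.
    Conversely, for points in distinct rows and columns the order of the boxes decides the order of
    the points.\<close>
  have G_eq: "G = (\<Union>q\<in>inc_maps k {..<m} \<times> inc_maps k {..<m}. P q)"
  proof (intro equalityI subsetI)
    fix f assume f: "f \<in> G"
    then have fi: "f \<in> inc_maps k {1..N}"
      and pat: "\<And>i j. i \<in> {1..k} \<Longrightarrow> j \<in> {1..k} \<Longrightarrow> \<pi> (f i) < \<pi> (f j) \<longleftrightarrow> \<sigma> i < \<sigma> j"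
      and inj: "inj_on (row \<circ> f) {1..k}" "inj_on (col \<circ> f) {1..k}"
      by (auto simp: G_def occurrences_def)
    note fin = inc_mapsD(2)[OF fi]
    define I where "I = (\<lambda>a\<in>{1..k}. row (f a))"
    \<comment> \<open>Columns are listed in increasing order, so position \<open>a\<close> belongs
      to the point at which \<open>\<sigma>\<close> takes the value \<open>a\<close>.\<close>
    define J where "J = (\<lambda>a\<in>{1..k}. col (f (\<iota> a)))"
    have "strict_mono_on {1..k} I"
    proof (rule strict_mono_onI)
      fix a b assume ab: "a \<in> {1..k}" "b \<in> {1..k}" "a < b"
      then have "f a < f b" using inc_maps_less_iff[OF fi] by auto
      then have "row (f a) \<le> row (f b)" by (intro row_mono) auto
      moreover have "row (f a) \<noteq> row (f b)" using inj_onD[OF inj(1), of a b] ab by auto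
      ultimately show "I a < I b" using ab by (auto simp: I_def)
    qed
    then have I: "I \<in> inc_maps k {..<m}" using row_lt fin by (auto simp: inc_maps_def I_def)
    have "strict_mono_on {1..k} J"
    proof (rule strict_mono_onI)
      fix a b assume ab: "a \<in> {1..k}" "b \<in> {1..k}" "a < b"
      then have "\<pi> (f (\<iota> a)) < \<pi> (f (\<iota> b))"
        using pat[OF \<sigma>i_in \<sigma>i_in] \<sigma>i(2) by auto
      then have "col (f (\<iota> a)) \<le> col (f (\<iota> b))"
        unfolding col_def by (intro row_mono) auto
      moreover have "col (f (\<iota> a)) \<noteq> col (f (\<iota> b))"
        using inj_onD[OF inj(2), of "\<iota> a" "\<iota> b"] ab \<sigma>i_in[of a] \<sigma>i_in[of b] \<sigma>i(2)
        by (metis comp_apply less_irrefl)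
      ultimately show "J a < J b" using ab by (auto simp: J_def)
    qed
    then have J: "J \<in> inc_maps k {..<m}"
      using row_lt[OF \<pi>_in[OF fin[OF \<sigma>i_in]]] by (auto simp: inc_maps_def J_def col_def)
    have "f \<in> P (I, J)"
      using inc_mapsD(1)[OF fi] \<sigma>_in by (auto simp: P_def PiE_iff cell_def I_def J_def \<sigma>i(1))
    with I J show "f \<in> (\<Union>q\<in>inc_maps k {..<m} \<times> inc_maps k {..<m}. P q)" by blast
  next
    fix f assume "f \<in> (\<Union>q\<in>inc_maps k {..<m} \<times> inc_maps k {..<m}. P q)"
    then obtain I J where I: "I \<in> inc_maps k {..<m}" and J: "J \<in> inc_maps k {..<m}"
      and f: "f \<in> P (I, J)" by auto
    have fc: "f a \<in> {1..N}" "row (f a) = I a" "row (\<pi> (f a)) = J (\<sigma> a)" if "a \<in> {1..k}" for a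
      using f that by (auto simp: P_def cell_def PiE_iff col_def)
    have "strict_mono_on {1..k} f"
    proof (rule strict_mono_onI)
      fix a b assume ab: "a \<in> {1..k}" "b \<in> {1..k}" "a < b"
      then have "I a < I b" using inc_maps_less_iff[OF I] by blast
      then show "f a < f b" using row_less[of "f a" "f b"] fc(2)[OF ab(1)] fc(2)[OF ab(2)] by simp
    qed
    moreover have "f \<in> {1..k} \<rightarrow>\<^sub>E {1..N}" using f by (auto simp: P_def cell_def PiE_iff)
    ultimately have fi: "f \<in> inc_maps k {1..N}" by (simp add: inc_maps_def)
    have col_less: "\<pi> (f a) < \<pi> (f b)" if "a \<in> {1..k}" "b \<in> {1..k}" "\<sigma> a < \<sigma> b" for a b
      using that inc_maps_less_iff[OF J \<sigma>_in[OF that(1)] \<sigma>_in[OF that(2)]]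
        row_less[of "\<pi> (f a)" "\<pi> (f b)"] fc(3)[OF that(1)] fc(3)[OF that(2)] by simp
    have pat: "\<pi> (f a) < \<pi> (f b) \<longleftrightarrow> \<sigma> a < \<sigma> b" if "a \<in> {1..k}" "b \<in> {1..k}" for a b
    proof (cases "\<sigma> a" "\<sigma> b" rule: linorder_cases)
      case equal
      then have "a = b" using injD[OF permutes_inj[OF \<sigma>]] by blast
      then show ?thesis by simp
    next
      case greater
      then show ?thesis using col_less[OF that(2,1)] by simp
    qed (use col_less[OF that] in simp)
    have "inj_on (row \<circ> f) {1..k}"
    proof (rule inj_onI)
      fix a b assume ab: "a \<in> {1..k}" "b \<in> {1..k}" "(row \<circ> f) a = (row \<circ> f) b"
      then have "I a = I b" using fc(2)[OF ab(1)] fc(2)[OF ab(2)] by simp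
      then show "a = b" using inj_onD[OF inc_mapsD(4)[OF I]] ab by blast
    qed
    moreover have "inj_on (col \<circ> f) {1..k}"
    proof (rule inj_onI)
      fix a b assume ab: "a \<in> {1..k}" "b \<in> {1..k}" "(col \<circ> f) a = (col \<circ> f) b"
      then have "J (\<sigma> a) = J (\<sigma> b)" using fc(3)[OF ab(1)] fc(3)[OF ab(2)] by (simp add: col_def)
      then have "\<sigma> a = \<sigma> b" using inj_onD[OF inc_mapsD(4)[OF J]] \<sigma>_in ab by blast
      then show "a = b" using injD[OF permutes_inj[OF \<sigma>]] by blast
    qed
    ultimately show "f \<in> G" using fi pat by (auto simp: G_def occurrences_def)
  qed
  have card_G: "card G = M"
  proof -
    have "disjoint_family_on P (inc_maps k {..<m} \<times> inc_maps k {..<m})"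
    proof (unfold disjoint_family_on_def, intro ballI impI)
      fix q q' assume q: "q \<in> inc_maps k {..<m} \<times> inc_maps k {..<m}"
        "q' \<in> inc_maps k {..<m} \<times> inc_maps k {..<m}" "q \<noteq> q'"
      show "P q \<inter> P q' = {}"
      proof (rule ccontr)
        assume "P q \<inter> P q' \<noteq> {}"
        then obtain f where f: "f \<in> P q" "f \<in> P q'" by blast
        obtain I J I' J' where [simp]: "q = (I, J)" "q' = (I', J')" by fastforce
        have e: "I a = I' a \<and> J (\<sigma> a) = J' (\<sigma> a)" if "a \<in> {1..k}" for a
          using f that by (auto simp: P_def PiE_iff cell_def)
        have "I = I'" using q e by (auto intro!: PiE_ext[of I "{1..k}" "\<lambda>_. {..<m}" I'] simp: inc_maps_def)
        moreover have "J a = J' a" if "a \<in> {1..k}" for a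
          using e[OF \<sigma>i_in[OF that]] by (simp add: \<sigma>i)
        then have "J = J'" using q by (auto intro!: PiE_ext[of J "{1..k}" "\<lambda>_. {..<m}" J'] simp: inc_maps_def)
        ultimately show False using q by simp
      qed
    qed
    then have "card G = (\<Sum>q\<in>inc_maps k {..<m} \<times> inc_maps k {..<m}. card (P q))"
      unfolding G_eq by (intro card_UN_disjoint')
        (auto simp: P_def cell_def intro!: finite_PiE)
    also have "\<dots> = (\<Sum>I\<in>inc_maps k {..<m}. \<Sum>J\<in>inc_maps k {..<m}. card (P (I, J)))"
      by (simp add: sum.cartesian_product)
    also have "\<dots> = M"
      unfolding M_def
    proof (intro sum.cong refl)
      fix I J assume IJ: "I \<in> inc_maps k {..<m}" "J \<in> inc_maps k {..<m}"
      have "card (P (I, J)) = (\<Prod>a\<in>{1..k}. card (cell (I a) (J (\<sigma> a))))"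
        unfolding P_def by (simp add: card_PiE)
      also have "\<dots> = (\<Prod>a\<in>{1..k}. K (I a) (J (\<sigma> a)))"
        using K inc_mapsD(2)[OF IJ(1)] inc_mapsD(2)[OF IJ(2)] \<sigma>_in
        by (intro prod.cong) (auto simp: cell_def row_def col_def N_def)
      finally show "card (P (I, J)) = (\<Prod>a\<in>{1..k}. K (I a) (J (\<sigma> a)))" .
    qed
    finally show ?thesis .
  qed
  have fin: "finite (occurrences k \<sigma> N \<pi>)" by (simp add: occurrences_def)
  have GO: "G \<subseteq> occurrences k \<sigma> N \<pi>" by (auto simp: G_def)
  show "M \<le> card (occurrences k \<sigma> (m * S) \<pi>)"
    using card_mono[OF fin GO] card_G by (simp add: N_def)
  have row_fib: "card {y \<in> {1..N}. row y = i} \<le> S" for i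
  proof -
    have "{y \<in> {1..N}. row y = i} \<subseteq> {i * S + 1..i * S + S}"
    proof
      fix x assume "x \<in> {y \<in> {1..N}. row y = i}"
      then show "x \<in> {i * S + 1..i * S + S}"
        using div_strip_eq[OF S, of x i] by (simp add: row_def)
    qed
    from card_mono[OF _ this] show ?thesis by simp
  qed
  have col_fib: "card {y \<in> {1..N}. col y = i} \<le> S" for i
  proof -
    have "\<pi> ` {y \<in> {1..N}. col y = i} \<subseteq> {y \<in> {1..N}. row y = i}" using \<pi>_in by (auto simp: col_def)
    then have "card {y \<in> {1..N}. col y = i} \<le> card {y \<in> {1..N}. row y = i}"
      using permutes_inj[OF \<pi>] by (intro card_inj_on_le[of \<pi>]) (auto intro: inj_on_subset)
    with row_fib[of i] show ?thesis by linarith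
  qed
  \<comment> \<open>Tuples in which the points \<open>a\<close> and \<open>b\<close> collide.
    Monotonicity is dropped, which only enlarges the set to be bounded.\<close>
  define E where "E = (\<lambda>h (a, b). {f \<in> {1..k} \<rightarrow>\<^sub>E {1..N}. (h::nat \<Rightarrow> nat) (f a) = h (f b)})"
  define D where "D = {(a, b) \<in> {1..k} \<times> {1..k}. a \<noteq> b}"
  have finD: "finite D" by (rule finite_subset[of _ "{1..k} \<times> {1..k}"]) (auto simp: D_def)
  have cardD: "card D \<le> k\<^sup>2"
  proof -
    have "D \<subseteq> {1..k} \<times> {1..k}" by (auto simp: D_def)
    then have "card D \<le> card ({1..k} \<times> {1..k})" by (intro card_mono) auto
    then show ?thesis by (simp add: card_cartesian_product power2_eq_square)
  qed
  have finE: "finite (E h q)" for h q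
    by (rule finite_subset[of _ "{1..k} \<rightarrow>\<^sub>E {1..N}"]) (auto simp: E_def finite_PiE split: prod.splits)
  have UN: "card (\<Union>q\<in>D. E h q) \<le> k\<^sup>2 * (N ^ (k - 1) * S)"
    if "\<And>i. card {y \<in> {1..N}. h y = i} \<le> S" for h
  proof -
    have "card (\<Union>q\<in>D. E h q) \<le> (\<Sum>q\<in>D. card (E h q))" by (rule card_UN_le[OF finD])
    also have "\<dots> \<le> (\<Sum>q\<in>D. N ^ (k - 1) * S)"
      using that card_PiE_collision_le[of "{1..N}" _ k _ h S]
      by (intro sum_mono) (auto simp: D_def E_def)
    also have "\<dots> \<le> k\<^sup>2 * (N ^ (k - 1) * S)" using cardD by simp
    finally show ?thesis .
  qed
  have "occurrences k \<sigma> N \<pi> \<subseteq> G \<union> ((\<Union>q\<in>D. E row q) \<union> (\<Union>q\<in>D. E col q))"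
  proof
    fix f assume f: "f \<in> occurrences k \<sigma> N \<pi>"
    then have f': "f \<in> {1..k} \<rightarrow>\<^sub>E {1..N}" by (auto simp: occurrences_def inc_maps_def)
    show "f \<in> G \<union> ((\<Union>q\<in>D. E row q) \<union> (\<Union>q\<in>D. E col q))"
    proof (cases "f \<in> G")
      case False
      then consider "\<not> inj_on (row \<circ> f) {1..k}" | "\<not> inj_on (col \<circ> f) {1..k}"
        using f by (auto simp: G_def)
      moreover have "f \<in> (\<Union>q\<in>D. E h q)" if ni: "\<not> inj_on (h \<circ> f) {1..k}" for h
      proof -
        obtain a b where "a \<in> {1..k}" "b \<in> {1..k}" "a \<noteq> b" "h (f a) = h (f b)"
          using ni unfolding inj_on_def comp_def by blast
        then have "(a, b) \<in> D" "f \<in> E h (a, b)" using f' by (auto simp: D_def E_def)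
        then show ?thesis by blast
      qed
      ultimately show ?thesis by cases blast+
    qed auto
  qed
  then have "card (occurrences k \<sigma> N \<pi>) \<le> card (G \<union> ((\<Union>q\<in>D. E row q) \<union> (\<Union>q\<in>D. E col q)))"
    using finite_subset[OF GO fin] finD finE by (intro card_mono) auto
  also have "\<dots> \<le> card G + (card (\<Union>q\<in>D. E row q) + card (\<Union>q\<in>D. E col q))"
    by (meson add_left_mono card_Un_le order_trans)
  also have "\<dots> \<le> M + (k\<^sup>2 * (N ^ (k - 1) * S) + k\<^sup>2 * (N ^ (k - 1) * S))"
    using card_G UN[OF row_fib] UN[OF col_fib] by linarith
  finally show "card (occurrences k \<sigma> (m * S) \<pi>) \<le> M + 2 * k\<^sup>2 * ((m * S) ^ (k - 1) * S)"
    by (simp add: N_def algebra_simps)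
qed

section \<open>Linear relations between permutation matrices\<close>

lemma sum_1_to_4: "sum g {1..4::nat} = g 1 + g 2 + g 3 + g 4"
  by (simp add: numeral_eq_Suc sum.atLeast_Suc_atMost add.assoc)

text \<open>Natural-number indices let the shifted arguments \<open>a - 1\<close> and
  \<open>b - 1\<close> run into the zero border. On \<open>{1..3}\<close> the map
  \<open>of_nat\<close> is a bijection onto the index type \<open>3\<close>, and
  \<open>real^3^3\<close> is a Euclidean space of dimension 9.\<close>

definition border :: "real^3^3 \<Rightarrow> nat \<Rightarrow> nat \<Rightarrow> real" where
  "border Z a b = (if a \<in> {1..3} \<and> b \<in> {1..3} then vec_nth (vec_nth Z (of_nat a)) (of_nat b) else 0)"

text \<open>The second difference of \<open>Z\<close> surrounded by zeros: a linear parametrisation of the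
  \<open>4 \<times> 4\<close> matrices with zero row and column sums.\<close>

definition zero_sum :: "real^3^3 \<Rightarrow> nat \<Rightarrow> nat \<Rightarrow> real" where
  "zero_sum Z a b = border Z a b - border Z (a - 1) b - border Z a (b - 1) + border Z (a - 1) (b - 1)"

text \<open>The inner product of \<open>zero_sum Z\<close> with the permutation matrix of
  \<open>\<sigma>\<close>; it becomes the first-order term of the density of
  \<open>\<sigma>\<close>.\<close>

definition perm_pairing :: "(nat \<Rightarrow> nat) \<Rightarrow> real^3^3 \<Rightarrow> real" where
  "perm_pairing \<sigma> Z = (\<Sum>a\<in>{1..4}. zero_sum Z a (\<sigma> a))"

text \<open>The sum telescopes, leaving values of \<open>border\<close> in columns 0 and 4, which
  vanish.\<close>

lemma sum_zero_sum_row: "(\<Sum>b\<in>{1..4}. zero_sum Z a b) = 0"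
  unfolding sum_1_to_4 by (simp add: zero_sum_def border_def)

lemma sum_zero_sum_col: "(\<Sum>a\<in>{1..4}. zero_sum Z a b) = 0"
  unfolding sum_1_to_4 by (simp add: zero_sum_def border_def)

lemma linear_border: "linear (\<lambda>Z. border Z a b)"
  by (rule linearI) (auto simp: border_def)

lemma linear_zero_sum: "linear (\<lambda>Z. zero_sum Z a b)"
  unfolding zero_sum_def by (intro linear_compose_add linear_compose_sub linear_border)

lemma linear_perm_pairing: "linear (perm_pairing \<sigma>)"
  unfolding perm_pairing_def by (intro linear_compose_sum ballI linear_zero_sum)

text \<open>Vanishing second differences express each entry by its neighbours with smaller indices;
  the induction starts from the zero border.\<close>

lemma border_eq_0:
  assumes "\<And>a b. a \<in> {1..4} \<Longrightarrow> b \<in> {1..4} \<Longrightarrow> zero_sum Z a b = 0"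
  shows "border Z a b = 0"
proof (induction a arbitrary: b)
  case (Suc a)
  note IH = this
  show ?case
  proof (induction b)
    case (Suc b)
    show ?case
    proof (cases "Suc a \<in> {1..4} \<and> Suc b \<in> {1..4}")
      case True
      then show ?thesis using assms[of "Suc a" "Suc b"] Suc IH by (auto simp: zero_sum_def)
    qed (auto simp: border_def)
  qed (simp add: border_def)
qed (simp add: border_def)

lemma eq_0_if_border_eq_0:
  assumes "\<And>a b. border Z a b = 0"
  shows "Z = 0"
proof -
  have "vec_nth (vec_nth Z i) j = 0" for i j
  proof -
    have i: "\<exists>a\<in>{1..3}. i = of_nat a" for i :: 3
      using exhaust_3[of i] by (metis atLeastAtMost_iff numeral_le_iff of_nat_1 of_nat_numeral one_le_numeral order_refl semiring_norm(68) semiring_norm(72))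
    obtain a b where "a \<in> {1..3}" "b \<in> {1..3}" "i = of_nat a" "j = of_nat b"
      using i[of i] i[of j] by blast
    then show ?thesis using assms[of a b] by (simp add: border_def)
  qed
  then show ?thesis by (simp add: vec_eq_iff)
qed

section \<open>Duality between zero-sum matrices and permutation matrices\<close>

text \<open>First \<open>a\<close> is swapped with \<open>c\<close>, which takes \<open>b\<close> to
  \<open>b'\<close>; then \<open>b'\<close> is swapped with \<open>d\<close>. The second swap fixes
  \<open>c\<close> since \<open>b'\<close> and \<open>d\<close> differ from it.\<close>

lemma ex_permutation_two_values:
  assumes "a \<in> A" "b \<in> A" "c \<in> A" "d \<in> A" "a \<noteq> b" "c \<noteq> d"
  shows "\<exists>\<tau>. \<tau> permutes A \<and> \<tau> a = c \<and> \<tau> b = d"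
proof -
  define b' where "b' = Transposition.transpose a c b"
  have b': "b' \<in> A" "b' \<noteq> c" using assms by (auto simp: b'_def Transposition.transpose_def)
  have "(Transposition.transpose b' d \<circ> Transposition.transpose a c) permutes A"
    using assms b' by (intro permutes_compose permutes_swap_id)
  moreover have "(Transposition.transpose b' d \<circ> Transposition.transpose a c) a = c" using assms b' by simp
  moreover have "(Transposition.transpose b' d \<circ> Transposition.transpose a c) b = d" by (simp add: b'_def)
  ultimately show ?thesis by blast
qed

text \<open>Two permutations that differ by a transposition give an exchange identity for any two
  rows and columns of \<open>zero_sum Z\<close>. Summed over a column index it makes all rows equal,
  and the zero column sums then kill all entries.\<close>

lemma perm_pairing_separates:
  assumes "\<And>\<tau>. \<tau> permutes {1..4} \<Longrightarrow> perm_pairing \<tau> Z = 0"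
  shows "Z = 0"
proof -
  let ?t = "zero_sum Z"
  have exch: "?t a c + ?t b d = ?t a d + ?t b c"
    if abcd: "a \<in> {1..4}" "b \<in> {1..4}" "c \<in> {1..4}" "d \<in> {1..4}" for a b c d
  proof (cases "a = b \<or> c = d")
    case False
    then obtain \<tau> where \<tau>: "\<tau> permutes {1..4}" "\<tau> a = c" "\<tau> b = d"
      using ex_permutation_two_values[OF abcd] by blast
    define \<tau>' where "\<tau>' = \<tau> \<circ> Transposition.transpose a b"
    have \<tau>': "\<tau>' permutes {1..4}"
      unfolding \<tau>'_def using abcd \<tau>(1) by (intro permutes_compose permutes_swap_id)
    have split: "perm_pairing \<rho> Z = ?t a (\<rho> a) + (?t b (\<rho> b) + (\<Sum>i\<in>{1..4} - {a} - {b}. ?t i (\<rho> i)))" for \<rho>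
      unfolding perm_pairing_def using abcd False sum.remove[of "{1..4}" a "\<lambda>i. ?t i (\<rho> i)"]
        sum.remove[of "{1..4} - {a}" b "\<lambda>i. ?t i (\<rho> i)"] by simp
    have "(\<Sum>i\<in>{1..4} - {a} - {b}. ?t i (\<tau> i)) = (\<Sum>i\<in>{1..4} - {a} - {b}. ?t i (\<tau>' i))"
      by (rule sum.cong) (auto simp: \<tau>'_def Transposition.transpose_def)
    then show ?thesis
      using split[of \<tau>] split[of \<tau>'] assms[OF \<tau>(1)] assms[OF \<tau>'] \<tau> by (simp add: \<tau>'_def)
  qed auto
  have eq: "?t a c = ?t b c" if "a \<in> {1..4}" "b \<in> {1..4}" "c \<in> {1..4}" for a b c
  proof -
    have "(\<Sum>d\<in>{1..4}. ?t a c + ?t b d) = (\<Sum>d\<in>{1..4}. ?t a d + ?t b c)"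
      using exch that by (intro sum.cong) auto
    then show ?thesis using sum_zero_sum_row[of Z a] sum_zero_sum_row[of Z b] by (simp add: sum.distrib)
  qed
  have "?t a c = 0" if "a \<in> {1..4}" "c \<in> {1..4}" for a c
  proof -
    have "(\<Sum>b\<in>{1..4}. ?t b c) = (\<Sum>b\<in>{1..4::nat}. ?t a c)"
      by (rule sum.cong[OF refl], rule eq) (use that in auto)
    then show ?thesis using sum_zero_sum_col[of Z c] by simp
  qed
  then show ?thesis by (intro eq_0_if_border_eq_0 border_eq_0)
qed

text \<open>Four linear conditions cannot exhaust a nine-dimensional space, so some nonzero
  \<open>Z\<close> pairs to zero with every \<open>q k\<close>. Some permutation detects it, since
  the pairings separate points.\<close>

lemma ex_separating_direction:
  fixes q :: "4 \<Rightarrow> nat \<Rightarrow> nat"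
  shows "\<exists>Z \<tau>. \<tau> permutes {1..4} \<and> perm_pairing \<tau> Z \<noteq> 0 \<and> (\<forall>k. perm_pairing (q k) Z = 0)"
proof -
  define f :: "real^3^3 \<Rightarrow> real^4" where "f = (\<lambda>Z. vec_lambda (\<lambda>k. perm_pairing (q k) Z))"
  have lin: "linear f"
    by (rule linearI) (auto simp: f_def vec_eq_iff linear_add[OF linear_perm_pairing] linear_scale[OF linear_perm_pairing])
  have "\<not> inj f"
  proof
    assume "inj f"
    then have "dim (range f) = dim (UNIV :: (real^3^3) set)"
      by (intro dim_image_eq[OF lin]) (auto intro: inj_on_subset)
    moreover have "dim (range f) \<le> 4" using dim_subset_UNIV[of "range f"] by simp
    ultimately show False by simp
  qed
  then obtain Z where Z: "f Z = 0" "Z \<noteq> 0" using linear_injective_0[OF lin] by auto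
  moreover from Z(2) perm_pairing_separates obtain \<tau> where "\<tau> permutes {1..4}" "perm_pairing \<tau> Z \<noteq> 0" by blast
  moreover have "perm_pairing (q k) Z = 0" for k using arg_cong[OF Z(1), of "\<lambda>v. vec_nth v k"] by (simp add: f_def)
  ultimately show ?thesis by blast
qed

lemma sum_of_bool_permutes:
  fixes \<sigma> :: "nat \<Rightarrow> nat"
  assumes "\<sigma> permutes {1..4}"
  shows "i \<in> {1..4} \<Longrightarrow> (\<Sum>j\<in>{1..4}. of_bool (\<sigma> i = j) * g j) = (g (\<sigma> i) :: real)"
    and "j \<in> {1..4} \<Longrightarrow> (\<Sum>i\<in>{1..4}. of_bool (\<sigma> i = j)) = (1 :: real)"
proof -
  show "(\<Sum>j\<in>{1..4}. of_bool (\<sigma> i = j) * g j) = g (\<sigma> i)" if "i \<in> {1..4}"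
    using permutes_in_image[OF assms] that by (simp add: of_bool_def if_distrib[of "\<lambda>x. x * _"] cong: if_cong)
  assume j: "j \<in> {1..4}"
  have "(\<Sum>i\<in>{1..4}. of_bool (\<sigma> i = j)) = (\<Sum>i\<in>{1..4}. (of_bool (i = j) :: real))"
    by (rule sum.permute[OF assms, of "\<lambda>i. of_bool (i = j)", unfolded comp_def, symmetric])
  then show "(\<Sum>i\<in>{1..4}. of_bool (\<sigma> i = j)) = (1 :: real)" using j by (simp add: of_bool_def)
qed

text \<open>Here \<open>of_bool (p k i = j)\<close> is an entry of a permutation matrix: a
  combination of pairings is the pairing with the combined matrix.\<close>

lemma linear_combination_perm_pairing:
  fixes p :: "'n::finite \<Rightarrow> nat \<Rightarrow> nat" and c :: "'n \<Rightarrow> real"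
  assumes "\<And>k. p k permutes {1..4}"
  shows "(\<Sum>k\<in>UNIV. c k * perm_pairing (p k) Z) =
    (\<Sum>i\<in>{1..4}. \<Sum>j\<in>{1..4}. (\<Sum>k\<in>UNIV. c k * of_bool (p k i = j)) * zero_sum Z i j)"
proof -
  have "(\<Sum>k\<in>UNIV. c k * perm_pairing (p k) Z) = (\<Sum>k\<in>UNIV. \<Sum>i\<in>{1..4}. c k * zero_sum Z i (p k i))"
    by (simp add: perm_pairing_def sum_distrib_left)
  also have "\<dots> = (\<Sum>k\<in>UNIV. \<Sum>i\<in>{1..4}. \<Sum>j\<in>{1..4}. c k * of_bool (p k i = j) * zero_sum Z i j)"
  proof (intro sum.cong refl)
    fix k i assume i: "i \<in> {1..4::nat}"
    show "c k * zero_sum Z i (p k i) = (\<Sum>j\<in>{1..4}. c k * of_bool (p k i = j) * zero_sum Z i j)"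
      unfolding sum_of_bool_permutes(1)[OF assms i, of k "zero_sum Z i", symmetric]
      by (simp only: sum_distrib_left mult.assoc)
  qed
  also have "\<dots> = (\<Sum>i\<in>{1..4}. \<Sum>k\<in>UNIV. \<Sum>j\<in>{1..4}. c k * of_bool (p k i = j) * zero_sum Z i j)"
    by (rule sum.swap)
  also have "\<dots> = (\<Sum>i\<in>{1..4}. \<Sum>j\<in>{1..4}. \<Sum>k\<in>UNIV. c k * of_bool (p k i = j) * zero_sum Z i j)"
    by (intro sum.cong refl sum.swap)
  finally show ?thesis by (simp only: sum_distrib_right)
qed

text \<open>If the pairings were not jointly onto, a nonzero vector \<open>v\<close> would be
  orthogonal to their range. The matrix \<open>B\<close> formed with the coefficients of
  \<open>v\<close> would annihilate all zero-sum matrices and hence be constant, against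
  independence modulo the all-one matrix.\<close>

lemma perm_pairing_right_inverse:
  fixes p :: "'n::finite \<Rightarrow> nat \<Rightarrow> nat"
  assumes p: "\<And>k. p k permutes {1..4}"
    and indep: "\<And>(c::'n \<Rightarrow> real) e. (\<And>i j. i \<in> {1..4} \<Longrightarrow> j \<in> {1..4} \<Longrightarrow>
        (\<Sum>k\<in>UNIV. c k * of_bool (p k i = j)) = e) \<Longrightarrow> (\<And>k. c k = 0)"
  shows "\<exists>H::real^'n \<Rightarrow> real^3^3. linear H \<and> (\<forall>s k. perm_pairing (p k) (H s) = vec_nth s k)"
proof -
  define f :: "real^3^3 \<Rightarrow> real^'n" where "f = (\<lambda>Z. vec_lambda (\<lambda>k. perm_pairing (p k) Z))"
  have lin: "linear f"
    by (rule linearI) (auto simp: f_def vec_eq_iff linear_add[OF linear_perm_pairing] linear_scale[OF linear_perm_pairing])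
  have "surj f"
  proof (rule ccontr)
    assume ns: "\<not> surj f"
    have "span (range f) = range f"
      using linear_subspace_image[OF lin subspace_UNIV] by (simp add: span_eq_iff)
    then have "span (range f) \<noteq> UNIV" using ns by (rule ssubst)
    from span_not_UNIV_orthogonal[OF this] obtain v where v: "v \<noteq> 0" "\<And>x. x \<in> range f \<Longrightarrow> inner v x = 0"
      using span_base by metis
    define c where "c = vec_nth v"
    define B where "B = (\<lambda>i j. \<Sum>k\<in>UNIV. c k * of_bool (p k i = j))"
    have orth: "(\<Sum>i\<in>{1..4}. \<Sum>j\<in>{1..4}. B i j * zero_sum Z i j) = 0" for Z
    proof -
      have "0 = inner v (f Z)" using v(2) by simp
      also have "\<dots> = (\<Sum>k\<in>UNIV. c k * perm_pairing (p k) Z)" by (simp add: inner_vec_def f_def c_def)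
      finally show ?thesis unfolding linear_combination_perm_pairing[OF p] B_def by simp
    qed
    \<comment> \<open>A single entry 1 in \<open>Z\<close> makes \<open>zero_sum Z\<close> the sign
      pattern \<open>+ - - +\<close> on the rows \<open>a\<close>, \<open>Suc a\<close> and the
      columns \<open>b\<close>, \<open>Suc b\<close>.\<close>
    have second_diff: "B a b - B (Suc a) b - B a (Suc b) + B (Suc a) (Suc b) = 0"
      if ab: "a \<in> {1, 2, 3}" "b \<in> {1, 2, 3}" for a b
    proof -
      define Z :: "real^3^3" where "Z = axis (of_nat a) (axis (of_nat b) 1)"
      have inj: "of_nat i = (of_nat a :: 3) \<longleftrightarrow> i = a" if "i \<in> {1..3}" "a \<in> {1..3}" for i a :: nat
      proof -
        have "i \<in> {1, 2, 3}" "a \<in> {1, 2, 3}" using that by auto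
        then show ?thesis by auto
      qed
      have "border Z i j = of_bool (i = a \<and> j = b)" for i j
        using ab inj[of i a] inj[of j b] by (auto simp: border_def Z_def axis_def)
      then show ?thesis using orth[of Z] ab unfolding sum_1_to_4 zero_sum_def
        by (auto simp flip: numeral_2_eq_2)
    qed
    define s where "s = (\<Sum>k\<in>UNIV. c k)"
    have row: "(\<Sum>j\<in>{1..4}. B i j) = s" if "i \<in> {1..4}" for i
      unfolding B_def s_def using sum_of_bool_permutes(1)[OF p that, of _ "\<lambda>_. 1"]
      by (subst sum.swap) (simp flip: sum_distrib_left)
    have col: "(\<Sum>i\<in>{1..4}. B i j) = s" if "j \<in> {1..4}" for j
      unfolding B_def s_def using sum_of_bool_permutes(2)[OF p that]
      by (subst sum.swap) (simp flip: sum_distrib_left)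
    \<comment> \<open>The difference of neighbouring rows is constant in \<open>b\<close> by
      \<open>second_diff\<close>, and it sums to zero because all rows of \<open>B\<close> have the
      sum \<open>s\<close>.\<close>
    have step: "B a b = B (Suc a) b" if "a \<in> {1, 2, 3}" "b \<in> {1..4}" for a b
    proof -
      define d where "d = (\<lambda>b. B a b - B (Suc a) b)"
      have "d 1 = d 2" using second_diff[OF that(1), of 1] by (simp add: d_def numeral_2_eq_2)
      moreover have "d 2 = d 3" using second_diff[OF that(1), of 2] by (simp add: d_def)
      moreover have "d 3 = d 4" using second_diff[OF that(1), of 3] by (simp add: d_def)
      moreover have "d 1 + d 2 + d 3 + d 4 = 0"
        using row[of a] row[of "Suc a"] that(1) unfolding sum_1_to_4 by (auto simp: d_def)
      ultimately have "d 1 = 0" "d 2 = 0" "d 3 = 0" "d 4 = 0" by auto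
      moreover have "b \<in> {1, 2, 3, 4}" using that(2) by auto
      ultimately have "d b = 0" by auto
      then show ?thesis by (simp add: d_def)
    qed
    have "B i j = s / 4" if "i \<in> {1..4}" "j \<in> {1..4}" for i j
    proof -
      have "B 1 j = B 2 j" "B 2 j = B 3 j" "B 3 j = B 4 j"
        using step[OF _ that(2), of 1] step[OF _ that(2), of 2] step[OF _ that(2), of 3]
        by (simp_all add: eval_nat_numeral)
      moreover have "i \<in> {1, 2, 3, 4}" using that(1) by auto
      ultimately show ?thesis using col[OF that(2)] unfolding sum_1_to_4 by auto
    qed
    then have "c k = 0" for k
      unfolding B_def by (intro indep[of c "s / 4"])
    then have "v = 0" by (simp add: vec_eq_iff c_def)
    with v(1) show False by contradiction
  qed
  then obtain H where "linear H" "f \<circ> H = id" using linear_surjective_right_inverse[OF lin] by blast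
  moreover have "perm_pairing (p k) (H s) = vec_nth s k" for s k
    using fun_cong[OF \<open>f \<circ> H = id\<close>, of s] by (auto simp: f_def vec_eq_iff)
  ultimately show ?thesis by blast
qed

section \<open>Linear relations among four permutation matrices\<close>

text \<open>The hypothesis is taken at the values \<open>w1\<close>, ..., \<open>w4\<close>
  themselves. Eliminating \<open>j\<close> leaves linear equations governed by the equalities
  between these values alone.\<close>

lemma zero_sum_blocks:
  fixes c1 c2 c3 c4 :: real and w1 w2 w3 w4 :: nat
  assumes H: "\<And>j. j \<in> {w1, w2, w3, w4} \<Longrightarrow>
    c1 * of_bool (w1 = j) + c2 * of_bool (w2 = j) + c3 * of_bool (w3 = j) + c4 * of_bool (w4 = j) = 0"
  shows "c1 + (if w1 = w2 then c2 else 0) + (if w1 = w3 then c3 else 0) + (if w1 = w4 then c4 else 0) = 0"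
    and "(if w1 = w2 then c1 else 0) + c2 + (if w2 = w3 then c3 else 0) + (if w2 = w4 then c4 else 0) = 0"
    and "(if w1 = w3 then c1 else 0) + (if w2 = w3 then c2 else 0) + c3 + (if w3 = w4 then c4 else 0) = 0"
    and "(if w1 = w4 then c1 else 0) + (if w2 = w4 then c2 else 0) + (if w3 = w4 then c3 else 0) + c4 = 0"
  using H[of w1] H[of w2] H[of w3] H[of w4] by (auto simp: of_bool_def split: if_splits)

text \<open>In every row the unordered pairs \<open>p i\<close>, \<open>q i\<close> and
  \<open>r i\<close>, \<open>s i\<close> agree, which is the equality of two sums of two permutation
  matrices.\<close>

definition same_sum :: "(nat \<Rightarrow> nat) \<Rightarrow> (nat \<Rightarrow> nat) \<Rightarrow> (nat \<Rightarrow> nat) \<Rightarrow> (nat \<Rightarrow> nat) \<Rightarrow> bool" where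
  "same_sum p q r s \<longleftrightarrow> (\<forall>i\<in>{1..4}. p i = r i \<and> q i = s i \<or> p i = s i \<and> q i = r i)"

text \<open>In every row the four indices split into classes of equal value, and the coefficients sum to
  zero on each class. So no class contains exactly one index of nonzero coefficient; as the
  permutations differ, all coefficients are nonzero and two different splittings into pairs occur.\<close>

lemma vanishing_combination_of_four:
  fixes c1 c2 c3 c4 :: real and p1 p2 p3 p4 :: "nat \<Rightarrow> nat"
  assumes perm: "p1 permutes {1..4}" "p2 permutes {1..4}" "p3 permutes {1..4}" "p4 permutes {1..4}"
    and dist: "distinct [p1, p2, p3, p4]"
    and comb: "\<And>i j. i \<in> {1..4} \<Longrightarrow> j \<in> {1..4} \<Longrightarrow>
      c1 * of_bool (p1 i = j) + c2 * of_bool (p2 i = j) + c3 * of_bool (p3 i = j) + c4 * of_bool (p4 i = j) = 0"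
    and nz: "\<not> (c1 = 0 \<and> c2 = 0 \<and> c3 = 0 \<and> c4 = 0)"
  shows "same_sum p1 p2 p3 p4 \<or> same_sum p1 p3 p2 p4 \<or> same_sum p1 p4 p2 p3"
proof -
  have rows: "p1 i \<in> {1..4} \<and> p2 i \<in> {1..4} \<and> p3 i \<in> {1..4} \<and> p4 i \<in> {1..4}" if "i \<in> {1..4}" for i
    using perm permutes_in_image that by metis
  have differ: "\<exists>i\<in>{1..4}. p i \<noteq> q i" if "p permutes {1..4}" "q permutes {1..4}" "p \<noteq> q" for p q :: "nat \<Rightarrow> nat"
  proof (rule ccontr)
    assume "\<not> ?thesis"
    then have "p x = q x" for x
      using permutes_not_in[OF that(1), of x] permutes_not_in[OF that(2), of x] by (cases "x \<in> {1..4}") auto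
    then have "p = q" by (rule ext)
    with that(3) show False by contradiction
  qed
  have blocks:
    "c1 + (if p1 i = p2 i then c2 else 0) + (if p1 i = p3 i then c3 else 0) + (if p1 i = p4 i then c4 else 0) = 0"
    "(if p1 i = p2 i then c1 else 0) + c2 + (if p2 i = p3 i then c3 else 0) + (if p2 i = p4 i then c4 else 0) = 0"
    "(if p1 i = p3 i then c1 else 0) + (if p2 i = p3 i then c2 else 0) + c3 + (if p3 i = p4 i then c4 else 0) = 0"
    "(if p1 i = p4 i then c1 else 0) + (if p2 i = p4 i then c2 else 0) + (if p3 i = p4 i then c3 else 0) + c4 = 0"
    if "i \<in> {1..4}" for i
  proof -
    have H: "c1 * of_bool (p1 i = j) + c2 * of_bool (p2 i = j) + c3 * of_bool (p3 i = j) + c4 * of_bool (p4 i = j) = 0"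
      if "j \<in> {p1 i, p2 i, p3 i, p4 i}" for j
      using comb[OF \<open>i \<in> {1..4}\<close>, of j] rows[OF \<open>i \<in> {1..4}\<close>] that by blast
    show
      "c1 + (if p1 i = p2 i then c2 else 0) + (if p1 i = p3 i then c3 else 0) + (if p1 i = p4 i then c4 else 0) = 0"
      "(if p1 i = p2 i then c1 else 0) + c2 + (if p2 i = p3 i then c3 else 0) + (if p2 i = p4 i then c4 else 0) = 0"
      "(if p1 i = p3 i then c1 else 0) + (if p2 i = p3 i then c2 else 0) + c3 + (if p3 i = p4 i then c4 else 0) = 0"
      "(if p1 i = p4 i then c1 else 0) + (if p2 i = p4 i then c2 else 0) + (if p3 i = p4 i then c3 else 0) + c4 = 0"
      by (rule zero_sum_blocks[OF H]; assumption)+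
  qed
  obtain i12 where i12: "i12 \<in> {1..4}" "p1 i12 \<noteq> p2 i12"
    using differ[OF perm(1) perm(2)] dist by auto
  obtain i13 where i13: "i13 \<in> {1..4}" "p1 i13 \<noteq> p3 i13"
    using differ[OF perm(1) perm(3)] dist by auto
  obtain i14 where i14: "i14 \<in> {1..4}" "p1 i14 \<noteq> p4 i14"
    using differ[OF perm(1) perm(4)] dist by auto
  obtain i23 where i23: "i23 \<in> {1..4}" "p2 i23 \<noteq> p3 i23"
    using differ[OF perm(2) perm(3)] dist by auto
  obtain i24 where i24: "i24 \<in> {1..4}" "p2 i24 \<noteq> p4 i24"
    using differ[OF perm(2) perm(4)] dist by auto
  obtain i34 where i34: "i34 \<in> {1..4}" "p3 i34 \<noteq> p4 i34"
    using differ[OF perm(3) perm(4)] dist by auto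
  \<comment> \<open>If \<open>c1 = 0\<close>, at most three coefficients are nonzero. No class holds
    exactly one of their indices, so these would share a class in every row, but any two
    permutations are separated in some row.\<close>
  have c1: "c1 \<noteq> 0" using nz blocks[OF i23(1)] blocks[OF i24(1)] blocks[OF i34(1)] i23 i24 i34 by (smt (verit))
  have c2: "c2 \<noteq> 0" using nz blocks[OF i13(1)] blocks[OF i14(1)] blocks[OF i34(1)] i13 i14 i34 by (smt (verit))
  have c3: "c3 \<noteq> 0" using nz blocks[OF i12(1)] blocks[OF i14(1)] blocks[OF i24(1)] i12 i14 i24 by (smt (verit))
  have c4: "c4 \<noteq> 0" using nz blocks[OF i12(1)] blocks[OF i13(1)] blocks[OF i23(1)] i12 i13 i23 by (smt (verit))
  \<comment> \<open>A row separating \<open>p1\<close> from another permutation splits into two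
    pairs of opposite coefficients. Three such rows make at least two of \<open>c1 + c2\<close>,
    \<open>c1 + c3\<close>, \<open>c1 + c4\<close> vanish; all three cannot, because the
    coefficients would add up to \<open>-2 * c1\<close>.\<close>
  have signs: "c1 + c2 \<noteq> 0 \<and> c1 + c3 = 0 \<and> c1 + c4 = 0 \<or> c1 + c3 \<noteq> 0 \<and> c1 + c2 = 0 \<and> c1 + c4 = 0 \<or>
    c1 + c4 \<noteq> 0 \<and> c1 + c2 = 0 \<and> c1 + c3 = 0"
    using c1 c2 c3 c4 blocks[OF i12(1)] blocks[OF i13(1)] blocks[OF i14(1)] i12 i13 i14 by (smt (verit))
  have total: "c1 + c2 + c3 + c4 = 0"
    using c1 c2 c3 c4 blocks[of 1] by (auto split: if_splits)
  from signs show ?thesis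
  proof (elim disjE)
    assume s: "c1 + c2 \<noteq> 0 \<and> c1 + c3 = 0 \<and> c1 + c4 = 0"
    \<comment> \<open>A row that pairs \<open>p1\<close> with \<open>p2\<close> and
      \<open>p3\<close> with \<open>p4\<close>, at different values, is excluded by
      \<open>c1 + c2 \<noteq> 0\<close>; a row with one common value satisfies both
      alternatives.\<close>
    have "p1 i = p3 i \<and> p2 i = p4 i \<or> p1 i = p4 i \<and> p2 i = p3 i" if "i \<in> {1..4}" for i
      using blocks[OF that] s c1 c2 c3 c4 total by (smt (verit))
    then show ?thesis by (simp add: same_sum_def)
  next
    assume s: "c1 + c3 \<noteq> 0 \<and> c1 + c2 = 0 \<and> c1 + c4 = 0"
    have "p1 i = p2 i \<and> p3 i = p4 i \<or> p1 i = p4 i \<and> p3 i = p2 i" if "i \<in> {1..4}" for i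
      using blocks[OF that] s c1 c2 c3 c4 total by (smt (verit))
    then show ?thesis by (simp add: same_sum_def)
  next
    assume s: "c1 + c4 \<noteq> 0 \<and> c1 + c2 = 0 \<and> c1 + c3 = 0"
    have "p1 i = p2 i \<and> p4 i = p3 i \<or> p1 i = p3 i \<and> p4 i = p2 i" if "i \<in> {1..4}" for i
      using blocks[OF that] s c1 c2 c3 c4 total by (smt (verit))
    then show ?thesis by (simp add: same_sum_def)
  qed
qed

text \<open>As \<open>e \<noteq> 0\<close>, every column occurs among the four values in row
  \<open>i\<close>, so these are the numbers 1 to 4, each exactly once.\<close>

lemma four_permutations_cover:
  fixes c1 c2 c3 c4 e :: real and p1 p2 p3 p4 :: "nat \<Rightarrow> nat"
  assumes perm: "p1 permutes {1..4}" "p2 permutes {1..4}" "p3 permutes {1..4}" "p4 permutes {1..4}"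
    and comb: "\<And>i j. i \<in> {1..4} \<Longrightarrow> j \<in> {1..4} \<Longrightarrow>
      c1 * of_bool (p1 i = j) + c2 * of_bool (p2 i = j) + c3 * of_bool (p3 i = j) + c4 * of_bool (p4 i = j) = e"
    and "e \<noteq> 0" and i: "i \<in> {1..4}" and j: "j \<in> {1..4}"
  shows "of_bool (p1 i = j) + of_bool (p2 i = j) + of_bool (p3 i = j) + of_bool (p4 i = j) = (1::int)"
proof -
  have "{1..4} \<subseteq> {p1 i, p2 i, p3 i, p4 i}"
  proof
    fix j :: nat assume "j \<in> {1..4}"
    then show "j \<in> {p1 i, p2 i, p3 i, p4 i}" using comb[OF i] \<open>e \<noteq> 0\<close> by fastforce
  qed
  then have "card {1..4::nat} \<le> card {p1 i, p2 i, p3 i, p4 i}" by (intro card_mono) auto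
  then have "distinct [p1 i, p2 i, p3 i, p4 i]" by (auto simp: card_insert_if split: if_splits)
  moreover have "j \<in> {p1 i, p2 i, p3 i, p4 i}" using \<open>{1..4} \<subseteq> _\<close> j by blast
  ultimately show ?thesis by auto
qed

lemma perm_matrix_sum_all_one:
  assumes "\<And>i j. i \<in> {1..4} \<Longrightarrow> j \<in> {1..4} \<Longrightarrow>
    of_bool (p1 i = j) + of_bool (p2 i = j) + of_bool (p3 i = j) + of_bool (p4 i = j) = (1::int)"
  shows "perm_matrix 4 p1 + perm_matrix 4 p2 + perm_matrix 4 p3 + perm_matrix 4 p4 = all_one_matrix 4"
proof (rule eq_matI)
  fix i j assume "i < dim_row (all_one_matrix 4)" "j < dim_col (all_one_matrix 4)"
  then have "i < 4" "j < 4" by (auto simp: all_one_matrix_def)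
  then show "(perm_matrix 4 p1 + perm_matrix 4 p2 + perm_matrix 4 p3 + perm_matrix 4 p4) $$ (i, j)
      = all_one_matrix 4 $$ (i, j)"
    using assms[of "Suc i" "Suc j"] by (simp add: perm_matrix_def all_one_matrix_def of_bool_def)
qed (auto simp: perm_matrix_def all_one_matrix_def)

lemma perm_matrix_eq_if_same_sum:
  assumes "same_sum p q r s"
  shows "perm_matrix 4 p + perm_matrix 4 q - perm_matrix 4 r - perm_matrix 4 s = 0\<^sub>m 4 4"
proof (rule eq_matI)
  fix i j assume "i < dim_row (0\<^sub>m 4 4 :: int mat)" "j < dim_col (0\<^sub>m 4 4 :: int mat)"
  then have "i < 4" "j < 4" by auto
  then show "(perm_matrix 4 p + perm_matrix 4 q - perm_matrix 4 r - perm_matrix 4 s) $$ (i, j) = 0\<^sub>m 4 4 $$ (i, j)"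
    using assms[unfolded same_sum_def, rule_format, of "Suc i"] by (auto simp: perm_matrix_def)
qed (auto simp: perm_matrix_def)

section \<open>Perturbing the uniform density\<close>

text \<open>Row \<open>b\<close> of the table is the Lagrange polynomial of the node \<open>b\<close> among \<open>1, 2, 3, 4\<close>, expanded in
  the rising factorials of its argument, with the coefficient of order \<open>r\<close> scaled by
  \<open>5 (5 + 1) \<dots> (5 + r - 1)\<close>.\<close>

definition dual_coeff :: "nat \<Rightarrow> nat \<Rightarrow> real" where
  "dual_coeff b r =
     [[4, -30, 60, -35], [-6, 70, -165, 105], [4, -55, 150, -105], [-1, 15, -45, 35]] ! (b - 1) ! r"

text \<open>The ratio of rising factorials is a discrete substitute for the \<open>r\<close>-th
  power of \<open>i / m\<close>; in this form the averages below do not depend on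
  \<open>m\<close>.\<close>

definition dual_fun :: "nat \<Rightarrow> nat \<Rightarrow> nat \<Rightarrow> real" where
  "dual_fun m b i = (\<Sum>r<4. dual_coeff b r * (pochhammer (real i + 1) r / pochhammer (real m + 1) r))"

lemma sum_lessThan_4: "(\<Sum>r<4. g r) = g 0 + g 1 + g 2 + g (3::nat)"
  by (simp add: eval_nat_numeral)

lemma pochhammer_1_2_3:
  "pochhammer x 1 = x" "pochhammer x 2 = x * (x + 1)" "pochhammer x 3 = x * (x + 1) * (x + 2)"
  for x :: real
  by (simp_all add: eval_nat_numeral pochhammer_Suc)

lemma pochhammer_real_Suc_pos: "pochhammer (real m + 1) r > 0"
  by (intro pochhammer_pos) simp

text \<open>The \<open>r\<close>-th moment divided by \<open>pochhammer (real m + 1) r\<close>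
  depends on \<open>m\<close> only through the factor \<open>m choose s\<close>. Both the order
  statistics, with \<open>s = 4\<close>, and a single index, with \<open>s = 1\<close>, are
  instances.\<close>

lemma sum_dual_fun_over:
  assumes "\<And>r. (\<Sum>f\<in>F. pochhammer (real (v f) + 1) r) = pochhammer (real k) r * real ((m + r) choose (s + r))"
  shows "(\<Sum>f\<in>F. dual_fun m b (v f)) =
    real (m choose s) * (\<Sum>r<4. dual_coeff b r * (pochhammer (real k) r / pochhammer (real s + 1) r))"
proof -
  have "(\<Sum>f\<in>F. dual_fun m b (v f)) =
      (\<Sum>r<4. dual_coeff b r * ((\<Sum>f\<in>F. pochhammer (real (v f) + 1) r) / pochhammer (real m + 1) r))"
    unfolding dual_fun_def by (subst sum.swap) (simp add: sum_distrib_left sum_divide_distrib)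
  also have "\<dots> = (\<Sum>r<4. real (m choose s) * (dual_coeff b r * (pochhammer (real k) r / pochhammer (real s + 1) r)))"
  proof (rule sum.cong[OF refl])
    fix r
    have "real ((m + r) choose (s + r)) / pochhammer (real m + 1) r = real (m choose s) / pochhammer (real s + 1) r"
      using pochhammer_mult_binomial[of m r s] pochhammer_real_Suc_pos[of m r] pochhammer_real_Suc_pos[of s r]
      by (simp add: field_simps)
    then show "dual_coeff b r * ((\<Sum>f\<in>F. pochhammer (real (v f) + 1) r) / pochhammer (real m + 1) r) =
        real (m choose s) * (dual_coeff b r * (pochhammer (real k) r / pochhammer (real s + 1) r))"
      unfolding assms by (metis (no_types, lifting) mult.assoc mult.commute times_divide_eq_right)
  qed
  finally show ?thesis by (simp only: sum_distrib_left)
qed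

text \<open>For \<open>s = 4\<close> the divisors \<open>pochhammer 5 r\<close> cancel the scaling
  of the table, and what remains is the Lagrange polynomial of the node \<open>b\<close> evaluated
  at \<open>k\<close>.\<close>

lemma sum_inc_maps_dual_fun:
  assumes b: "b \<in> {1..4}" and k: "k \<in> {1..4}"
  shows "(\<Sum>f\<in>inc_maps 4 {..<m}. dual_fun m b (f k)) = of_bool (b = k) * real (m choose 4)"
proof -
  have "(\<Sum>f\<in>inc_maps 4 {..<m}. dual_fun m b (f k)) =
    real (m choose 4) * (\<Sum>r<4. dual_coeff b r * (pochhammer (real k) r / pochhammer (real 4 + 1) r))"
    by (rule sum_dual_fun_over) (rule sum_inc_maps_pochhammer, use k in auto)
  moreover have "(\<Sum>r<4. dual_coeff b r * (pochhammer (real k) r / pochhammer (real 4 + 1) r)) = of_bool (b = k)"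
  proof -
    have "b \<in> {1, 2, 3, 4}" "k \<in> {1, 2, 3, 4}" using b k by auto
    then show ?thesis
      unfolding sum_lessThan_4 pochhammer_1_2_3
      by (elim insertE emptyE; simp add: dual_coeff_def)
  qed
  ultimately show ?thesis by simp
qed

text \<open>The mean is the same for every \<open>b\<close>, which is why zero-sum coefficients
  yield a perturbation with vanishing marginals. The value 1/4 reflects that the four order
  statistics average to a uniform point.\<close>

lemma sum_dual_fun:
  assumes b: "b \<in> {1..4}"
  shows "(\<Sum>i<m. dual_fun m b i) = real m / 4"
proof -
  have "(\<Sum>i<m. dual_fun m b i) =
    real (m choose 1) * (\<Sum>r<4. dual_coeff b r * (pochhammer (real 1) r / pochhammer (real 1 + 1) r))"
  proof (rule sum_dual_fun_over)
    show "(\<Sum>i<m. pochhammer (real i + 1) r) = pochhammer (real 1) r * real (m + r choose (1 + r))" for r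
      using sum_inc_maps_pochhammer[of 1 1 r m] sum_inc_maps_one[of "\<lambda>i. pochhammer (real i + 1) r" m] by simp
  qed
  moreover have "(\<Sum>r<4. dual_coeff b r * (pochhammer (real 1) r / pochhammer (real 1 + 1) r)) = 1 / 4"
  proof -
    have "b \<in> {1, 2, 3, 4}" using b by auto
    then show ?thesis
      unfolding sum_lessThan_4 pochhammer_1_2_3
      by (elim insertE emptyE; simp add: dual_coeff_def)
  qed
  ultimately show ?thesis by simp
qed

text \<open>The largest table entry in absolute value is 165, the ratios of rising factorials are at
  most 1, and 660 is \<open>4 * 165\<close>.\<close>

lemma abs_dual_fun_le:
  assumes b: "b \<in> {1..4}" and i: "i < m"
  shows "\<bar>dual_fun m b i\<bar> \<le> 660"
proof -
  have "\<bar>dual_fun m b i\<bar> \<le> (\<Sum>r<4. \<bar>dual_coeff b r * (pochhammer (real i + 1) r / pochhammer (real m + 1) r)\<bar>)"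
    unfolding dual_fun_def by (rule sum_abs)
  also have "\<dots> \<le> (\<Sum>r<4::nat. 165)"
  proof (rule sum_mono)
    fix r :: nat assume "r \<in> {..<4}"
    then have "r \<in> {0, 1, 2, 3}" by auto
    moreover have "b \<in> {1, 2, 3, 4}" using b by auto
    ultimately have c: "\<bar>dual_coeff b r\<bar> \<le> 165"
      by (elim insertE emptyE; simp add: dual_coeff_def)
    have le: "pochhammer (real i + 1) r \<le> pochhammer (real m + 1) r"
      unfolding pochhammer_prod using i by (intro prod_mono) auto
    then have "\<bar>pochhammer (real i + 1) r / pochhammer (real m + 1) r\<bar> \<le> 1"
      using pochhammer_real_Suc_pos[of i r] pochhammer_real_Suc_pos[of m r] by simp
    with c have "\<bar>dual_coeff b r\<bar> * \<bar>pochhammer (real i + 1) r / pochhammer (real m + 1) r\<bar> \<le> 165 * 1"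
      by (intro mult_mono) auto
    then show "\<bar>dual_coeff b r * (pochhammer (real i + 1) r / pochhammer (real m + 1) r)\<bar> \<le> 165"
      by (simp add: abs_mult)
  qed
  finally show ?thesis by simp
qed

lemma pochhammer_real_Suc_Rats: "pochhammer (real i + 1) r \<in> \<rat>"
  unfolding pochhammer_prod by (intro Rats_prod) auto

lemma dual_fun_Rats:
  assumes b: "b \<in> {1..4}"
  shows "dual_fun m b i \<in> \<rat>"
  unfolding dual_fun_def
proof (intro Rats_sum Rats_mult Rats_divide pochhammer_real_Suc_Rats)
  fix r :: nat assume "r \<in> {..<4}"
  then have "r \<in> {0, 1, 2, 3}" by auto
  moreover have "b \<in> {1, 2, 3, 4}" using b by auto
  ultimately show "dual_coeff b r \<in> \<rat>" by (elim insertE emptyE; simp add: dual_coeff_def)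
qed

section \<open>Weights on the grid and their pattern densities\<close>

definition weight :: "nat \<Rightarrow> real^3^3 \<Rightarrow> nat \<Rightarrow> nat \<Rightarrow> real" where
  "weight m Z i j = 1 + (\<Sum>a\<in>{1..4}. \<Sum>b\<in>{1..4}. zero_sum Z a b * dual_fun m a i * dual_fun m b j)"

lemma sum_weight_row: "(\<Sum>j<m. weight m Z i j) = real m"
proof -
  have "(\<Sum>j<m. \<Sum>a\<in>{1..4}. \<Sum>b\<in>{1..4}. zero_sum Z a b * dual_fun m a i * dual_fun m b j)
    = (\<Sum>a\<in>{1..4}. \<Sum>j<m. \<Sum>b\<in>{1..4}. zero_sum Z a b * dual_fun m a i * dual_fun m b j)"
    by (rule sum.swap)
  also have "\<dots> = (\<Sum>a\<in>{1..4}. \<Sum>b\<in>{1..4}. \<Sum>j<m. zero_sum Z a b * dual_fun m a i * dual_fun m b j)"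
    by (intro sum.cong refl sum.swap)
  also have "\<dots> = (\<Sum>a\<in>{1..4}. \<Sum>b\<in>{1..4}. zero_sum Z a b * (dual_fun m a i * (real m / 4)))"
    by (intro sum.cong refl) (simp only: mult.assoc sum_dual_fun flip: sum_distrib_left)
  also have "\<dots> = 0" by (simp only: sum_zero_sum_row flip: sum_distrib_right) simp
  finally show ?thesis by (simp add: weight_def sum.distrib)
qed

lemma sum_weight_col: "(\<Sum>i<m. weight m Z i j) = real m"
proof -
  have "(\<Sum>i<m. \<Sum>a\<in>{1..4}. \<Sum>b\<in>{1..4}. zero_sum Z a b * dual_fun m a i * dual_fun m b j)
    = (\<Sum>a\<in>{1..4}. \<Sum>i<m. \<Sum>b\<in>{1..4}. zero_sum Z a b * dual_fun m a i * dual_fun m b j)"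
    by (rule sum.swap)
  also have "\<dots> = (\<Sum>a\<in>{1..4}. \<Sum>b\<in>{1..4}. \<Sum>i<m. zero_sum Z a b * dual_fun m a i * dual_fun m b j)"
    by (intro sum.cong refl sum.swap)
  also have "\<dots> = (\<Sum>a\<in>{1..4}. \<Sum>b\<in>{1..4}. zero_sum Z a b * ((real m / 4) * dual_fun m b j))"
    by (intro sum.cong refl)
      (simp only: mult.assoc sum_dual_fun flip: sum_distrib_left sum_distrib_right)
  also have "\<dots> = (\<Sum>b\<in>{1..4}. \<Sum>a\<in>{1..4}. zero_sum Z a b * ((real m / 4) * dual_fun m b j))"
    by (rule sum.swap)
  also have "\<dots> = 0" by (simp only: sum_zero_sum_col flip: sum_distrib_right) simp
  finally show ?thesis by (simp add: weight_def sum.distrib)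
qed

lemma abs_zero_sum_le: "\<bar>zero_sum Z a b\<bar> \<le> 4 * norm Z"
proof -
  have B: "\<bar>border Z a b\<bar> \<le> norm Z" for a b
    unfolding border_def using component_le_norm_cart[of "vec_nth Z (of_nat a)" "of_nat b"]
      Finite_Cartesian_Product.norm_nth_le[of Z "of_nat a"] by auto
  show ?thesis
    using B[of a b] B[of "a - 1" b] B[of a "b - 1"] B[of "a - 1" "b - 1"]
    unfolding zero_sum_def abs_le_iff by linarith
qed

text \<open>Sixteen index pairs, a factor 4 from \<open>abs_zero_sum_le\<close> and 660 for each of
  the two dual functions.\<close>

definition weight_bound :: real where "weight_bound = 64 * 660\<^sup>2"

lemma abs_weight_minus_1_le:
  assumes "i < m" "j < m"
  shows "\<bar>weight m Z i j - 1\<bar> \<le> weight_bound * norm Z"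
proof -
  have "\<bar>weight m Z i j - 1\<bar> \<le>
      (\<Sum>a\<in>{1..4}. \<bar>\<Sum>b\<in>{1..4}. zero_sum Z a b * dual_fun m a i * dual_fun m b j\<bar>)"
    unfolding weight_def by (simp only: add_diff_cancel_left' sum_abs)
  also have "\<dots> \<le> (\<Sum>a\<in>{1..4}. \<Sum>b\<in>{1..4}. \<bar>zero_sum Z a b * dual_fun m a i * dual_fun m b j\<bar>)"
    by (intro sum_mono sum_abs)
  also have "\<dots> \<le> (\<Sum>a\<in>{1..4::nat}. \<Sum>b\<in>{1..4::nat}. (4 * norm Z) * 660 * 660)"
    unfolding abs_mult
    by (intro sum_mono mult_mono abs_zero_sum_le abs_dual_fun_le assms) auto
  also have "\<dots> = weight_bound * norm Z" by (simp add: weight_bound_def)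
  finally show ?thesis .
qed

lemma continuous_weight [continuous_intros]: "continuous_on X (\<lambda>Z. weight m Z i j)"
  unfolding weight_def
  by (intro continuous_intros linear_continuous_on) (simp add: linear_conv_bounded_linear[symmetric] linear_zero_sum)

text \<open>Rational weights on a finite grid have a common denominator, so they can be scaled to
  integer box counts.\<close>

lemma weight_Rats:
  assumes "\<And>i j. vec_nth (vec_nth Z i) j \<in> \<rat>"
  shows "weight m Z i j \<in> \<rat>"
proof -
  have "border Z a b \<in> \<rat>" for a b using assms by (simp add: border_def)
  then have "zero_sum Z a b \<in> \<rat>" for a b unfolding zero_sum_def by (intro Rats_add Rats_diff)
  then show ?thesis unfolding weight_def by (intro Rats_add Rats_sum Rats_mult dual_fun_Rats) auto
qed

text \<open>An average over rows \<open>I\<close> and columns \<open>J\<close> of products of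
  weights in boxes arranged as \<open>\<sigma>\<close>. For \<open>m \<ge> 4\<close> its value at
  \<open>Z = 0\<close> is 1, so densities are measured relative to 1/24.\<close>

definition grid_density :: "nat \<Rightarrow> (nat \<Rightarrow> nat) \<Rightarrow> real^3^3 \<Rightarrow> real" where
  "grid_density m \<sigma> Z =
     (\<Sum>I\<in>inc_maps 4 {..<m}. \<Sum>J\<in>inc_maps 4 {..<m}. \<Prod>a\<in>{1..4}. weight m Z (I a) (J (\<sigma> a)))
       / (real (m choose 4))\<^sup>2"

lemma continuous_grid_density: "continuous_on X (grid_density m \<sigma>)"
  unfolding grid_density_def divide_inverse by (intro continuous_intros)

text \<open>In the induction the new factor \<open>1 + x y\<close> at most doubles the old error,
  and the product \<open>T * x y\<close> adds at most \<open>card A * \<xi>\<^sup>2\<close>;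
  together this stays within a factor 4 of the old bound.\<close>

lemma abs_prod_linearisation_le:
  fixes x :: "'a \<Rightarrow> real"
  assumes "finite A" "\<And>a. a \<in> A \<Longrightarrow> \<bar>x a\<bar> \<le> \<xi>" "\<xi> \<le> 1" "0 \<le> \<xi>"
  shows "\<bar>(\<Prod>a\<in>A. 1 + x a) - 1 - (\<Sum>a\<in>A. x a)\<bar> \<le> 4 ^ card A * \<xi>\<^sup>2"
  using assms(1,2)
proof (induction A rule: finite_induct)
  case (insert y A)
  define P where "P = (\<Prod>a\<in>A. 1 + x a)"
  define T where "T = (\<Sum>a\<in>A. x a)"
  have IH: "\<bar>P - 1 - T\<bar> \<le> 4 ^ card A * \<xi>\<^sup>2" using insert by (simp add: P_def T_def)
  have y: "\<bar>x y\<bar> \<le> \<xi>" using insert by simp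
  have "\<bar>T\<bar> \<le> (\<Sum>a\<in>A. \<xi>)"
    unfolding T_def using insert by (intro order_trans[OF sum_abs] sum_mono) auto
  then have T: "\<bar>T\<bar> \<le> real (card A) * \<xi>" by simp
  have "\<bar>P - 1 - T\<bar> * \<bar>1 + x y\<bar> \<le> (4 ^ card A * \<xi>\<^sup>2) * 2"
    using IH y assms(3) by (intro mult_mono) auto
  moreover have "\<bar>T\<bar> * \<bar>x y\<bar> \<le> (real (card A) * \<xi>) * \<xi>"
    using T y assms(4) by (intro mult_mono) auto
  moreover have "real (card A) \<le> 4 ^ card A"
    using of_nat_less_two_power[of "card A", where ?'a = real] power_mono[of 2 "4::real" "card A"] by simp
  then have "real (card A) * \<xi>\<^sup>2 \<le> 4 ^ card A * \<xi>\<^sup>2" by (intro mult_right_mono) auto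
  moreover have "(1 + x y) * P - 1 - (x y + T) = (P - 1 - T) * (1 + x y) + T * x y"
    by (simp add: algebra_simps)
  then have "\<bar>(1 + x y) * P - 1 - (x y + T)\<bar> \<le> \<bar>P - 1 - T\<bar> * \<bar>1 + x y\<bar> + \<bar>T\<bar> * \<bar>x y\<bar>"
    by (simp only: abs_mult[symmetric] abs_triangle_ineq)
  moreover have "0 \<le> 4 ^ card A * \<xi>\<^sup>2" by simp
  ultimately have "\<bar>(1 + x y) * P - 1 - (x y + T)\<bar> \<le> 4 * 4 ^ card A * \<xi>\<^sup>2"
    by (simp add: power2_eq_square algebra_simps)
  then show ?case using insert by (simp add: P_def T_def)
qed auto

text \<open>The biorthogonality of \<open>dual_fun\<close> makes the linear term independent of \<open>m\<close>.\<close>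

lemma grid_density_linearisation:
  assumes m: "m \<ge> 4" and \<sigma>: "\<sigma> permutes {1..4}" and Z: "weight_bound * norm Z \<le> 1"
  shows "\<bar>grid_density m \<sigma> Z - 1 - perm_pairing \<sigma> Z\<bar> \<le> 256 * (weight_bound * norm Z)\<^sup>2"
proof -
  define F where "F = inc_maps 4 {..<m}"
  define C where "C = real (m choose 4)"
  define x where "x = (\<lambda>I J a. weight m Z (I a) (J (\<sigma> a)) - 1)"
  define E where "E = (\<lambda>I J. (\<Prod>a\<in>{1..4}. weight m Z (I a) (J (\<sigma> a))) - 1 - (\<Sum>a\<in>{1..4}. x I J a))"
  have C: "C > 0" using m by (simp add: C_def)
  have cF: "real (card F) = C" by (simp add: F_def C_def card_inc_maps)
  have \<sigma>_in: "\<sigma> a \<in> {1..4}" if "a \<in> {1..4}" for a using permutes_in_image[OF \<sigma>] that by simp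
  have E: "\<bar>E I J\<bar> \<le> 256 * (weight_bound * norm Z)\<^sup>2" if IJ: "I \<in> F" "J \<in> F" for I J
  proof -
    have "\<bar>x I J a\<bar> \<le> weight_bound * norm Z" if "a \<in> {1..4}" for a
      unfolding x_def using inc_mapsD(2)[of _ 4 "{..<m}"] IJ that \<sigma>_in[OF that]
      by (intro abs_weight_minus_1_le) (auto simp: F_def)
    from abs_prod_linearisation_le[of "{1..4}" "x I J", OF _ this Z]
    show ?thesis by (simp add: E_def x_def weight_bound_def)
  qed
  \<comment> \<open>The sums over \<open>I\<close> and \<open>J\<close> factor, and biorthogonality
    keeps only the term with \<open>c = a\<close> and \<open>d = \<sigma> a\<close>.\<close>
  have lin: "(\<Sum>I\<in>F. \<Sum>J\<in>F. x I J a) = C\<^sup>2 * zero_sum Z a (\<sigma> a)" if a: "a \<in> {1..4}" for a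
  proof -
    let ?g = "\<lambda>c d I J. zero_sum Z c d * dual_fun m c (I a) * dual_fun m d (J (\<sigma> a))"
    have "(\<Sum>I\<in>F. \<Sum>J\<in>F. x I J a) = (\<Sum>I\<in>F. \<Sum>J\<in>F. \<Sum>c\<in>{1..4}. \<Sum>d\<in>{1..4}. ?g c d I J)"
      by (simp add: x_def weight_def)
    also have "\<dots> = (\<Sum>I\<in>F. \<Sum>c\<in>{1..4}. \<Sum>J\<in>F. \<Sum>d\<in>{1..4}. ?g c d I J)"
      by (intro sum.cong refl sum.swap)
    also have "\<dots> = (\<Sum>c\<in>{1..4}. \<Sum>I\<in>F. \<Sum>J\<in>F. \<Sum>d\<in>{1..4}. ?g c d I J)"
      by (rule sum.swap)
    also have "\<dots> = (\<Sum>c\<in>{1..4}. \<Sum>I\<in>F. \<Sum>d\<in>{1..4}. \<Sum>J\<in>F. ?g c d I J)"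
      by (intro sum.cong refl sum.swap)
    also have "\<dots> = (\<Sum>c\<in>{1..4}. \<Sum>d\<in>{1..4}. \<Sum>I\<in>F. \<Sum>J\<in>F. ?g c d I J)"
      by (intro sum.cong refl sum.swap)
    also have "\<dots> = (\<Sum>c\<in>{1..4}. \<Sum>d\<in>{1..4}. zero_sum Z c d * (of_bool (c = a) * C) * (of_bool (d = \<sigma> a) * C))"
    proof (intro sum.cong refl)
      fix c d assume cd: "c \<in> {1..4::nat}" "d \<in> {1..4::nat}"
      have "(\<Sum>I\<in>F. \<Sum>J\<in>F. ?g c d I J) =
          zero_sum Z c d * (\<Sum>I\<in>F. dual_fun m c (I a)) * (\<Sum>J\<in>F. dual_fun m d (J (\<sigma> a)))"
        by (simp only: flip: sum_distrib_left sum_distrib_right)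
      then show "(\<Sum>I\<in>F. \<Sum>J\<in>F. ?g c d I J) = zero_sum Z c d * (of_bool (c = a) * C) * (of_bool (d = \<sigma> a) * C)"
        unfolding F_def C_def sum_inc_maps_dual_fun[OF cd(1) a] sum_inc_maps_dual_fun[OF cd(2) \<sigma>_in[OF a]] .
    qed
    also have "\<dots> = (\<Sum>c\<in>{1..4}. \<Sum>d\<in>{1..4}. if c = a then (if d = \<sigma> a then C\<^sup>2 * zero_sum Z c d else 0) else 0)"
      by (intro sum.cong refl) (auto simp: power2_eq_square)
    also have "\<dots> = (\<Sum>c\<in>{1..4}. if c = a then C\<^sup>2 * zero_sum Z c (\<sigma> a) else 0)"
      using \<sigma>_in[OF a] by (intro sum.cong refl) (auto simp: sum.delta)
    also have "\<dots> = C\<^sup>2 * zero_sum Z a (\<sigma> a)" using a by (auto simp: sum.delta)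
    finally show ?thesis .
  qed
  have "(\<Sum>I\<in>F. \<Sum>J\<in>F. \<Sum>a\<in>{1..4}. x I J a) = (\<Sum>I\<in>F. \<Sum>a\<in>{1..4}. \<Sum>J\<in>F. x I J a)"
    by (intro sum.cong refl sum.swap)
  also have "\<dots> = (\<Sum>a\<in>{1..4}. \<Sum>I\<in>F. \<Sum>J\<in>F. x I J a)" by (rule sum.swap)
  also have "\<dots> = (\<Sum>a\<in>{1..4}. C\<^sup>2 * zero_sum Z a (\<sigma> a))" by (intro sum.cong refl lin)
  finally have S: "(\<Sum>I\<in>F. \<Sum>J\<in>F. \<Sum>a\<in>{1..4}. x I J a) = C\<^sup>2 * perm_pairing \<sigma> Z"
    by (simp only: perm_pairing_def sum_distrib_left)
  have "(\<Sum>I\<in>F. \<Sum>J\<in>F. E I J) =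
      (\<Sum>I\<in>F. \<Sum>J\<in>F. \<Prod>a\<in>{1..4}. weight m Z (I a) (J (\<sigma> a))) - (\<Sum>I\<in>F. \<Sum>J\<in>F. 1)
       - (\<Sum>I\<in>F. \<Sum>J\<in>F. \<Sum>a\<in>{1..4}. x I J a)"
    by (simp only: E_def sum_subtractf)
  also have "\<dots> = C\<^sup>2 * grid_density m \<sigma> Z - C\<^sup>2 - C\<^sup>2 * perm_pairing \<sigma> Z"
    unfolding S using C by (simp add: grid_density_def F_def[symmetric] C_def[symmetric] cF power2_eq_square)
  finally have "C\<^sup>2 * (grid_density m \<sigma> Z - 1 - perm_pairing \<sigma> Z) = (\<Sum>I\<in>F. \<Sum>J\<in>F. E I J)"
    by (simp add: algebra_simps)
  then have "C\<^sup>2 * \<bar>grid_density m \<sigma> Z - 1 - perm_pairing \<sigma> Z\<bar> = \<bar>\<Sum>I\<in>F. \<Sum>J\<in>F. E I J\<bar>"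
    by (metis abs_mult abs_of_nonneg zero_le_power2)
  also have "\<dots> \<le> (\<Sum>I\<in>F. \<Sum>J\<in>F. 256 * (weight_bound * norm Z)\<^sup>2)"
    by (intro order_trans[OF sum_abs] sum_mono E)
  also have "\<dots> = C\<^sup>2 * (256 * (weight_bound * norm Z)\<^sup>2)" by (simp add: cF power2_eq_square)
  finally show ?thesis using C by simp
qed

section \<open>Attaining prescribed densities\<close>

text \<open>Along \<open>H s\<close> the densities are \<open>1 + s + R s\<close> with a
  quadratically small remainder \<open>R\<close>, so the equation becomes the fixed point problem
  \<open>s = y - R s\<close>, solved by Brouwer's theorem on a ball. The linearisation bound is the
  same for every \<open>m\<close>, and so is the radius.\<close>

lemma ex_grid_densities:
  fixes p :: "'n::finite \<Rightarrow> nat \<Rightarrow> nat" and H :: "real^'n \<Rightarrow> real^3^3"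
  assumes p: "\<And>k. p k permutes {1..4}" and H: "linear H"
    and inv: "\<And>s k. perm_pairing (p k) (H s) = vec_nth s k"
  shows "\<exists>\<rho>>0. \<forall>m\<ge>4. \<forall>y. norm y \<le> \<rho> \<longrightarrow>
    (\<exists>Z. weight_bound * norm Z \<le> 1 / 2 \<and> (\<forall>k. grid_density m (p k) Z = 1 + vec_nth y k))"
proof -
  obtain h where h: "h > 0" "\<And>s. norm (H s) \<le> h * norm s"
    using linear_bounded_pos[OF H] by blast
  define c where "c = weight_bound * h"
  have c: "c > 0" using h by (simp add: c_def weight_bound_def)
  define L where "L = real CARD('n) * (256 * c\<^sup>2)"
  have L: "L > 0" using c by (simp add: L_def)
  \<comment> \<open>\<open>c * r \<le> 1 / 2\<close> keeps the perturbation in the range of the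
    linearisation, and \<open>L * r \<le> 1 / 2\<close> bounds the remainder by
    \<open>r / 2\<close>, which leaves \<open>r / 2\<close> for \<open>y\<close>.\<close>
  define r where "r = min (1 / (2 * c)) (1 / (2 * L))"
  have r: "r > 0" "c * r \<le> 1 / 2" "L * r \<le> 1 / 2"
    using c L by (auto simp: r_def min_def field_simps)
  have "\<exists>Z. weight_bound * norm Z \<le> 1 / 2 \<and> (\<forall>k. grid_density m (p k) Z = 1 + vec_nth y k)"
    if m: "m \<ge> 4" and y: "norm y \<le> r / 2" for m and y :: "real^'n"
  proof -
    define R :: "real^'n \<Rightarrow> real^'n" where
      "R = (\<lambda>s. vec_lambda (\<lambda>k. grid_density m (p k) (H s) - 1 - perm_pairing (p k) (H s)))"
    have HZ: "weight_bound * norm (H s) \<le> c * norm s" for s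
      using mult_left_mono[OF h(2)[of s], of weight_bound] by (simp add: c_def weight_bound_def)
    have small: "weight_bound * norm (H s) \<le> 1 / 2" if "norm s \<le> r" for s
      using HZ[of s] mult_left_mono[OF that, of c] c r(2) by linarith
    have R: "norm (R s) \<le> r / 2" if s: "norm s \<le> r" for s
    proof -
      have "\<bar>vec_nth (R s) k\<bar> \<le> 256 * (c * r)\<^sup>2" for k
      proof -
        have "\<bar>vec_nth (R s) k\<bar> \<le> 256 * (weight_bound * norm (H s))\<^sup>2"
          unfolding R_def using grid_density_linearisation[OF m p, of "H s" k] small[OF s] by simp
        also have "\<dots> \<le> 256 * (c * r)\<^sup>2"
        proof (intro mult_left_mono power_mono)
          show "weight_bound * norm (H s) \<le> c * r" using HZ[of s] mult_left_mono[OF s, of c] c by linarith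
        qed (auto simp: weight_bound_def)
        finally show ?thesis .
      qed
      then have "(\<Sum>k\<in>UNIV. \<bar>vec_nth (R s) k\<bar>) \<le> (\<Sum>k\<in>(UNIV::'n set). 256 * (c * r)\<^sup>2)"
        by (intro sum_mono)
      also have "\<dots> = (L * r) * r" by (simp add: L_def power2_eq_square algebra_simps)
      also have "\<dots> \<le> (1 / 2) * r" using r by (intro mult_right_mono) auto
      finally show ?thesis using norm_le_l1_cart[of "R s"] by simp
    qed
    have contH: "continuous_on X H" for X
      using H by (simp add: linear_continuous_on linear_conv_bounded_linear)
    have "continuous_on (cball 0 r) (\<lambda>s. y - R s)"
      unfolding R_def inv
      by (intro continuous_intros continuous_on_vec_lambda
          continuous_on_compose2[OF continuous_grid_density[of UNIV] contH]) auto
    moreover have "(\<lambda>s. y - R s) \<in> cball 0 r \<rightarrow> cball 0 r"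
    proof
      fix s :: "real^'n" assume "s \<in> cball 0 r"
      then show "y - R s \<in> cball 0 r"
        using R[of s] y norm_triangle_ineq4[of y "R s"] by simp
    qed
    ultimately obtain s where s: "s \<in> cball 0 r" "y - R s = s"
      using brouwer_ball[OF r(1), of 0 "\<lambda>s. y - R s"] by blast
    have "grid_density m (p k) (H s) = 1 + vec_nth y k" for k
      using arg_cong[OF s(2), of "\<lambda>v. vec_nth v k"] by (simp add: R_def inv)
    moreover have "weight_bound * norm (H s) \<le> 1 / 2" using s(1) by (intro small) simp
    ultimately show ?thesis by blast
  qed
  then show ?thesis using r(1) by (intro exI[of _ "r / 2"]) auto
qed

text \<open>Nine entries, each off by less than \<open>e / 10\<close>, amount to less than
  \<open>e\<close> in total.\<close>

lemma ex_rational_matrix_near: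
  fixes Z :: "real^3^3"
  assumes "e > 0"
  shows "\<exists>Z'. (\<forall>i j. vec_nth (vec_nth Z' i) j \<in> \<rat>) \<and> dist Z' Z < e"
proof -
  have "\<exists>q. q \<in> \<rat> \<and> \<bar>q - vec_nth (vec_nth Z i) j\<bar> < e / 10" for i j
    using Rats_dense_in_real[of "vec_nth (vec_nth Z i) j" "vec_nth (vec_nth Z i) j + e / 10"] assms by force
  then obtain q where q: "\<And>i j. q i j \<in> \<rat>" "\<And>i j. \<bar>q i j - vec_nth (vec_nth Z i) j\<bar> < e / 10" by metis
  define Z' :: "real^3^3" where "Z' = vec_lambda (\<lambda>i. vec_lambda (q i))"
  have row: "norm (vec_nth (Z' - Z) i) \<le> 3 * (e / 10)" for i
  proof -
    have "norm (vec_nth (Z' - Z) i) \<le> (\<Sum>j\<in>UNIV. \<bar>vec_nth (vec_nth (Z' - Z) i) j\<bar>)" by (rule norm_le_l1_cart)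
    also have "\<dots> \<le> (\<Sum>j\<in>(UNIV::3 set). e / 10)"
      using q(2) by (intro sum_mono) (auto simp: Z'_def less_imp_le)
    finally show ?thesis by simp
  qed
  have "norm (Z' - Z) \<le> (\<Sum>i\<in>UNIV. norm (vec_nth (Z' - Z) i))"
    unfolding norm_vec_def by (rule L2_set_le_sum) auto
  also have "\<dots> \<le> (\<Sum>i\<in>(UNIV::3 set). 3 * (e / 10))" by (intro sum_mono row)
  also have "\<dots> < e" using assms by simp
  finally show ?thesis using q(1) by (intro exI[of _ Z']) (simp add: Z'_def dist_norm)
qed

text \<open>At fixed \<open>m\<close> only finitely many continuous functions are involved. The
  bound 1/2 leaves room below 1, where the weights are still positive.\<close>

lemma ex_rational_grid_densities:
  fixes p :: "'n::finite \<Rightarrow> nat \<Rightarrow> nat"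
  assumes "weight_bound * norm Z \<le> 1 / 2" and e: "e > 0"
  shows "\<exists>Z'. (\<forall>i j. vec_nth (vec_nth Z' i) j \<in> \<rat>) \<and> weight_bound * norm Z' < 1 \<and>
    (\<forall>k. \<bar>grid_density m (p k) Z' - grid_density m (p k) Z\<bar> < e)"
proof -
  have "eventually (\<lambda>Z'. dist (grid_density m (p k) Z') (grid_density m (p k) Z) < e) (nhds Z)" for k
    using continuous_grid_density[of UNIV m "p k"] e
    by (intro tendstoD) (auto simp: continuous_on_eq_continuous_at isCont_def tendsto_at_iff_tendsto_nhds)
  then have 1: "eventually (\<lambda>Z'. \<forall>k. dist (grid_density m (p k) Z') (grid_density m (p k) Z) < e) (nhds Z)"
    by (rule eventually_all_finite)
  have "((\<lambda>Z'. weight_bound * norm Z') \<longlongrightarrow> weight_bound * norm Z) (nhds Z)"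
    by (intro tendsto_intros filterlim_ident)
  then have 2: "eventually (\<lambda>Z'. weight_bound * norm Z' < 1) (nhds Z)"
    using assms(1) by (intro order_tendstoD(2)) auto
  from eventually_conj[OF 1 2] obtain d where d: "d > 0"
    "\<And>Z'. dist Z' Z < d \<Longrightarrow> (\<forall>k. dist (grid_density m (p k) Z') (grid_density m (p k) Z) < e) \<and> weight_bound * norm Z' < 1"
    unfolding eventually_nhds_metric by blast
  from ex_rational_matrix_near[OF d(1), of Z] d(2) show ?thesis
    unfolding dist_real_def by blast
qed

section \<open>From rational weights to permutations\<close>

lemma ex_common_denominator:
  assumes "finite X" "X \<subseteq> (\<rat> :: real set)"
  shows "\<exists>D::nat. D > 0 \<and> (\<forall>x\<in>X. real D * x \<in> \<int>)"
  using assms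
proof (induction X rule: finite_induct)
  case (insert x X)
  then obtain D :: nat where D: "D > 0" "\<forall>x\<in>X. real D * x \<in> \<int>" by auto
  have "x \<in> \<rat>" using insert by simp
  then obtain a :: int and b :: nat where b: "b \<noteq> 0" "x = of_int a / of_nat b"
    unfolding Rats_eq_int_div_nat by blast
  show ?case
  proof (intro exI[of _ "D * b"] conjI ballI)
    show "D * b > 0" using D b by simp
    fix y assume "y \<in> insert x X"
    then show "real (D * b) * y \<in> \<int>"
    proof
      assume "y = x"
      then have "real (D * b) * y = of_int (int D * a)" using b by simp
      then show ?thesis by (metis Ints_of_int)
    next
      assume "y \<in> X"
      then have "real D * y \<in> \<int>" using D by blast
      then have "real b * (real D * y) \<in> \<int>" by (rule Ints_mult[OF Ints_of_nat])
      then show ?thesis by (simp add: mult_ac)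
    qed
  qed
qed (auto intro: exI[of _ 1])

text \<open>With a common denominator \<open>D\<close>, the integers \<open>D * weight\<close> have
  row and column sums \<open>D * m\<close> and so are the box counts of a permutation of
  \<open>N = D * m\<^sup>2\<close> points. The factor before \<open>grid_density\<close> converts
  between the normalisations.\<close>

lemma ex_permutation_near_grid:
  assumes m: "m \<ge> 4" and rat: "\<And>i j. vec_nth (vec_nth Z i) j \<in> \<rat>" and Z: "weight_bound * norm Z < 1"
  shows "\<exists>N \<pi>. N \<ge> m \<and> \<pi> permutes {1..N} \<and> (\<forall>\<sigma>. \<sigma> permutes {1..4} \<longrightarrow>
    \<bar>pattern_density 4 \<sigma> N \<pi> -
       (real (m choose 4) / real m ^ 4)\<^sup>2 / (real (N choose 4) / real N ^ 4) * grid_density m \<sigma> Z\<bar> \<le> 8192 / real m)"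
proof -
  have "\<exists>D::nat. D > 0 \<and> (\<forall>x\<in>(\<lambda>(i, j). weight m Z i j) ` ({..<m} \<times> {..<m}). real D * x \<in> \<int>)"
    by (rule ex_common_denominator) (auto intro: weight_Rats[OF rat])
  then obtain D :: nat where D: "D > 0" "\<And>i j. i < m \<Longrightarrow> j < m \<Longrightarrow> real D * weight m Z i j \<in> \<int>" by auto
  have pos: "weight m Z i j > 0" if "i < m" "j < m" for i j
    using abs_weight_minus_1_le[OF that, of Z] Z by linarith
  \<comment> \<open>Rounding changes nothing: by the choice of \<open>D\<close> the products are
    integers, and they are positive.\<close>
  define K where "K = (\<lambda>i j. nat \<lfloor>real D * weight m Z i j\<rfloor>)"
  have K: "real (K i j) = real D * weight m Z i j" if "i < m" "j < m" for i j
  proof -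
    have "of_int \<lfloor>real D * weight m Z i j\<rfloor> = real D * weight m Z i j"
      using D(2)[OF that] by (auto elim: Ints_cases)
    moreover have "real D * weight m Z i j \<ge> 0" using pos[OF that] by simp
    ultimately show ?thesis by (simp add: K_def)
  qed
  define S where "S = D * m"
  define N where "N = m * S"
  have S: "S > 0" using D m by (simp add: S_def)
  have "(\<Sum>j<m. K i j) = S" if "i < m" for i
  proof -
    have "real (\<Sum>j<m. K i j) = (\<Sum>j<m. real D * weight m Z i j)"
      using that by (simp add: K)
    also have "\<dots> = real S" by (simp add: S_def sum_weight_row flip: sum_distrib_left)
    finally show ?thesis by (simp only: of_nat_eq_iff)
  qed
  moreover have "(\<Sum>i<m. K i j) = S" if "j < m" for j
  proof -
    have "real (\<Sum>i<m. K i j) = (\<Sum>i<m. real D * weight m Z i j)"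
      using that by (simp add: K)
    also have "\<dots> = real S" by (simp add: S_def sum_weight_col flip: sum_distrib_left)
    finally show ?thesis by (simp only: of_nat_eq_iff)
  qed
  ultimately obtain \<pi> where \<pi>: "\<pi> permutes {1..m * S}"
    "\<And>i j. i < m \<Longrightarrow> j < m \<Longrightarrow> card {x \<in> {1..m * S}. (x - 1) div S = i \<and> (\<pi> x - 1) div S = j} = K i j"
    using ex_permutation_with_box_counts[of m K S] S by blast
  have Nm: "N \<ge> m" using S by (simp add: N_def)
  then have N4: "N \<ge> 4" using m by simp
  have mr: "real m > 0" and Nr: "real N > 0" using m N4 by auto
  have NE: "real N = real D * (real m)\<^sup>2" by (simp add: N_def S_def power2_eq_square)
  have choose: "(real N / 4) ^ 4 \<le> real (N choose 4)"
    using binomial_ge_n_over_k_pow_k[OF N4, where ?'a = real] by simp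
  have "\<bar>pattern_density 4 \<sigma> N \<pi> -
       (real (m choose 4) / real m ^ 4)\<^sup>2 / (real (N choose 4) / real N ^ 4) * grid_density m \<sigma> Z\<bar> \<le> 8192 / real m"
    if \<sigma>: "\<sigma> permutes {1..4}" for \<sigma>
  proof -
    define M where "M = (\<Sum>I\<in>inc_maps 4 {..<m}. \<Sum>J\<in>inc_maps 4 {..<m}. \<Prod>a\<in>{1..4}. K (I a) (J (\<sigma> a)))"
    define W where "W = (\<Sum>I\<in>inc_maps 4 {..<m}. \<Sum>J\<in>inc_maps 4 {..<m}. \<Prod>a\<in>{1..4}. weight m Z (I a) (J (\<sigma> a)))"
    have "real M = (\<Sum>I\<in>inc_maps 4 {..<m}. \<Sum>J\<in>inc_maps 4 {..<m}. real D ^ 4 * (\<Prod>a\<in>{1..4}. weight m Z (I a) (J (\<sigma> a))))"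
      unfolding M_def of_nat_sum
    proof (intro sum.cong refl)
      fix I J assume IJ: "I \<in> inc_maps 4 {..<m}" "J \<in> inc_maps 4 {..<m}"
      have "real (\<Prod>a\<in>{1..4}. K (I a) (J (\<sigma> a))) = (\<Prod>a\<in>{1..4}. real D * weight m Z (I a) (J (\<sigma> a)))"
        unfolding of_nat_prod
      proof (intro prod.cong refl K)
        fix a assume a: "a \<in> {1..4::nat}"
        then have "\<sigma> a \<in> {1..4}" using permutes_in_image[OF \<sigma>] by blast
        then show "I a < m" "J (\<sigma> a) < m" using inc_mapsD(2)[OF IJ(1) a] inc_mapsD(2)[OF IJ(2)] by auto
      qed
      then show "real (\<Prod>a\<in>{1..4}. K (I a) (J (\<sigma> a))) = real D ^ 4 * (\<Prod>a\<in>{1..4}. weight m Z (I a) (J (\<sigma> a)))"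
        by (simp add: prod.distrib)
    qed
    also have "\<dots> = real D ^ 4 * W" by (simp only: W_def sum_distrib_left)
    finally have MW: "real M = real D ^ 4 * W" .
    \<comment> \<open>Since \<open>N ^ 4 = D ^ 4 * m ^ 8\<close>, the powers of \<open>m\<close>
      cancel and \<open>D ^ 4 * W = M\<close> is left.\<close>
    have e1: "(real (m choose 4) / real m ^ 4)\<^sup>2 / (real (N choose 4) / real N ^ 4) * grid_density m \<sigma> Z
        = real M / real (N choose 4)"
    proof -
      have "real (m choose 4) > 0" using m by simp
      then show ?thesis
        unfolding MW grid_density_def W_def[symmetric] NE using mr
        by (simp add: power_mult_distrib power_divide field_simps flip: power_mult)
    qed
    have e2: "pattern_density 4 \<sigma> N \<pi> = real (card (occurrences 4 \<sigma> N \<pi>)) / real (N choose 4)"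
      by (rule pattern_density_eq_occurrences)
    have lower: "M \<le> card (occurrences 4 \<sigma> N \<pi>)"
      and upper: "card (occurrences 4 \<sigma> N \<pi>) \<le> M + 2 * 4\<^sup>2 * (N ^ (4 - 1) * S)"
      using card_occurrences_box_counts[OF S \<pi>(1) \<sigma> \<pi>(2)] by (simp_all only: M_def N_def)
    have "\<bar>pattern_density 4 \<sigma> N \<pi> -
       (real (m choose 4) / real m ^ 4)\<^sup>2 / (real (N choose 4) / real N ^ 4) * grid_density m \<sigma> Z\<bar>
       = (real (card (occurrences 4 \<sigma> N \<pi>)) - real M) / real (N choose 4)"
      unfolding e1 e2 using lower by (simp flip: diff_divide_distrib)
    \<comment> \<open>The collision bound contributes \<open>2 * 4\<^sup>2 = 32\<close>; dividing by
      \<open>(N / 4) ^ 4\<close> in place of \<open>N choose 4\<close> turns it into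
      \<open>32 * 4 ^ 4 = 8192\<close>.\<close>
    also have "\<dots> \<le> (32 * real N ^ 3 * real S) / real (N choose 4)"
    proof (rule divide_right_mono)
      have "real (card (occurrences 4 \<sigma> N \<pi>)) \<le> real (M + 2 * 4\<^sup>2 * (N ^ (4 - 1) * S))"
        using upper by (simp only: of_nat_le_iff)
      then show "real (card (occurrences 4 \<sigma> N \<pi>)) - real M \<le> 32 * real N ^ 3 * real S" by simp
    qed simp
    also have "\<dots> \<le> (32 * real N ^ 3 * real S) / (real N / 4) ^ 4"
      using choose Nr N4 by (intro divide_left_mono mult_pos_pos) auto
    also have "\<dots> = 8192 * (real S / real N)"
      using Nr by (simp add: power_divide field_simps power_eq_if)
    also have "real S / real N = 1 / real m" using S by (simp add: N_def)
    finally show ?thesis by simp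
  qed
  moreover have "\<pi> permutes {1..N}" using \<pi>(1) by (simp only: N_def)
  ultimately show ?thesis using Nm by blast
qed

lemma choose_4_asymptotics: "(\<lambda>n. real (n choose 4) / real n ^ 4) \<longlonglongrightarrow> 1 / 24"
proof -
  have "real (n choose 4) = real n * (real n - 1) * (real n - 2) * (real n - 3) / 24" for n
    by (simp add: binomial_gbinomial gbinomial_prod_rev eval_nat_numeral prod.atLeast0_lessThan_Suc)
  moreover have "(\<lambda>n. real n * (real n - 1) * (real n - 2) * (real n - 3) / 24 / real n ^ 4) \<longlonglongrightarrow> 1 / 24"
    by real_asymp
  ultimately show ?thesis by (simp only:)
qed

text \<open>At grid size \<open>m\<close> the target is hit exactly by some \<open>Z\<close>, up to
  \<open>1 / m\<close> by a rational \<open>Z\<close>, and up to a further \<open>O(1/m)\<close> by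
  a permutation. One radius \<open>\<rho>\<close> serves all \<open>m\<close>, so \<open>y\<close>
  stays fixed as \<open>m\<close> grows.\<close>

lemma ex_permutation_sequence:
  fixes p :: "'n::finite \<Rightarrow> nat \<Rightarrow> nat" and H :: "real^'n \<Rightarrow> real^3^3"
  assumes p: "\<And>k. p k permutes {1..4}" and H: "linear H"
    and inv: "\<And>s k. perm_pairing (p k) (H s) = vec_nth s k"
  shows "\<exists>\<rho>>0. \<forall>y. norm y \<le> \<rho> \<longrightarrow> (\<exists>N \<pi>. (\<forall>n. \<pi> n permutes {1..N n}) \<and> filterlim N at_top sequentially \<and>
    (\<forall>k. (\<lambda>n. pattern_density 4 (p k) (N n) (\<pi> n)) \<longlonglongrightarrow> (1 + vec_nth y k) / 24))"
proof -
  obtain \<rho> where \<rho>: "\<rho> > 0" "\<And>m y. m \<ge> 4 \<Longrightarrow> norm y \<le> \<rho> \<Longrightarrow>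
    \<exists>Z. weight_bound * norm Z \<le> 1 / 2 \<and> (\<forall>k. grid_density m (p k) Z = 1 + vec_nth y k)"
    using ex_grid_densities[OF p H inv] by blast
  have "\<exists>N \<pi>. (\<forall>n. \<pi> n permutes {1..N n}) \<and> filterlim N at_top sequentially \<and>
    (\<forall>k. (\<lambda>n. pattern_density 4 (p k) (N n) (\<pi> n)) \<longlonglongrightarrow> (1 + vec_nth y k) / 24)" if y: "norm y \<le> \<rho>" for y
  proof -
    define m where "m = (\<lambda>n::nat. n + 4)"
    have "\<exists>N \<pi> Z. N \<ge> m n \<and> \<pi> permutes {1..N} \<and>
        (\<forall>k. \<bar>grid_density (m n) (p k) Z - (1 + vec_nth y k)\<bar> < 1 / real (m n)) \<and>
        (\<forall>k. \<bar>pattern_density 4 (p k) N \<pi> - (real (m n choose 4) / real (m n) ^ 4)\<^sup>2 /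
           (real (N choose 4) / real N ^ 4) * grid_density (m n) (p k) Z\<bar> \<le> 8192 / real (m n))" for n
    proof -
      have m4: "m n \<ge> 4" by (simp add: m_def)
      from \<rho>(2)[OF m4 y] obtain Z0 where Z0: "weight_bound * norm Z0 \<le> 1 / 2"
        "\<And>k. grid_density (m n) (p k) Z0 = 1 + vec_nth y k" by blast
      have "1 / real (m n) > 0" by (simp add: m_def)
      from ex_rational_grid_densities[OF Z0(1) this, of "m n" p] obtain Z where
        Z: "\<And>i j. vec_nth (vec_nth Z i) j \<in> \<rat>" "weight_bound * norm Z < 1"
        "\<And>k. \<bar>grid_density (m n) (p k) Z - (1 + vec_nth y k)\<bar> < 1 / real (m n)"
        unfolding Z0(2) by blast
      from ex_permutation_near_grid[OF m4 Z(1,2)] Z(3) p show ?thesis by metis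
    qed
    then obtain N \<pi> Z where N: "\<And>n. N n \<ge> m n" and \<pi>: "\<And>n. \<pi> n permutes {1..N n}"
      and Z: "\<And>n k. \<bar>grid_density (m n) (p k) (Z n) - (1 + vec_nth y k)\<bar> < 1 / real (m n)"
      and d: "\<And>n k. \<bar>pattern_density 4 (p k) (N n) (\<pi> n) - (real (m n choose 4) / real (m n) ^ 4)\<^sup>2 /
           (real (N n choose 4) / real (N n) ^ 4) * grid_density (m n) (p k) (Z n)\<bar> \<le> 8192 / real (m n)"
      by metis
    have mt: "filterlim m at_top sequentially" unfolding m_def by real_asymp
    have Nt: "filterlim N at_top sequentially"
      by (rule filterlim_at_top_mono[OF mt]) (use N in auto)
    have "(\<lambda>n. pattern_density 4 (p k) (N n) (\<pi> n)) \<longlonglongrightarrow> (1 + vec_nth y k) / 24" for k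
    proof -
      have z1: "(\<lambda>n. 1 / real (m n)) \<longlonglongrightarrow> 0" and z2: "(\<lambda>n. 8192 / real (m n)) \<longlonglongrightarrow> 0"
        unfolding m_def by real_asymp+
      have "(\<lambda>n. grid_density (m n) (p k) (Z n) - (1 + vec_nth y k)) \<longlonglongrightarrow> 0"
        by (rule Lim_null_comparison[OF _ z1]) (use Z in \<open>auto intro!: always_eventually simp: less_imp_le\<close>)
      then have g: "(\<lambda>n. grid_density (m n) (p k) (Z n)) \<longlonglongrightarrow> 1 + vec_nth y k"
        by (simp add: LIM_zero_iff)
      define R where "R = (\<lambda>n. (real (m n choose 4) / real (m n) ^ 4)\<^sup>2 / (real (N n choose 4) / real (N n) ^ 4))"
      have "R \<longlonglongrightarrow> (1 / 24)\<^sup>2 / (1 / 24)"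
        unfolding R_def
        by (intro tendsto_intros filterlim_compose[OF choose_4_asymptotics mt]
            filterlim_compose[OF choose_4_asymptotics Nt]) auto
      with g have "(\<lambda>n. R n * grid_density (m n) (p k) (Z n)) \<longlonglongrightarrow> (1 / 24)\<^sup>2 / (1 / 24) * (1 + vec_nth y k)"
        by (intro tendsto_mult)
      moreover have "(\<lambda>n. pattern_density 4 (p k) (N n) (\<pi> n) - R n * grid_density (m n) (p k) (Z n)) \<longlonglongrightarrow> 0"
        by (rule Lim_null_comparison[OF _ z2]) (use d in \<open>auto intro!: always_eventually simp: R_def\<close>)
      ultimately have "(\<lambda>n. R n * grid_density (m n) (p k) (Z n) +
          (pattern_density 4 (p k) (N n) (\<pi> n) - R n * grid_density (m n) (p k) (Z n)))
          \<longlonglongrightarrow> (1 / 24)\<^sup>2 / (1 / 24) * (1 + vec_nth y k) + 0" by (rule tendsto_add)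
      then show ?thesis by (simp add: power2_eq_square)
    qed
    with \<pi> Nt show ?thesis by blast
  qed
  then show ?thesis using \<rho>(1) by blast
qed

section \<open>Independence modulo the all-one matrix contradicts quasirandom forcing\<close>

theorem theorem9:
  fixes \<pi>1 \<pi>2 \<pi>3 \<pi>4 :: "nat \<Rightarrow> nat"
  assumes "\<pi>1 permutes {1..4}" "\<pi>2 permutes {1..4}" "\<pi>3 permutes {1..4}" "\<pi>4 permutes {1..4}"
    and "distinct [\<pi>1, \<pi>2, \<pi>3, \<pi>4]"
    and "quasirandom_forcing {(4, \<pi>1), (4, \<pi>2), (4, \<pi>3), (4, \<pi>4)}"
  shows "perm_matrix 4 \<pi>1 + perm_matrix 4 \<pi>2 + perm_matrix 4 \<pi>3 + perm_matrix 4 \<pi>4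
           = all_one_matrix 4 \<or>
         (\<exists>\<rho>1 \<rho>2 \<rho>3 \<rho>4. {\<rho>1, \<rho>2, \<rho>3, \<rho>4} = {\<pi>1, \<pi>2, \<pi>3, \<pi>4} \<and>
           perm_matrix 4 \<rho>1 + perm_matrix 4 \<rho>2 - perm_matrix 4 \<rho>3 - perm_matrix 4 \<rho>4 = 0\<^sub>m 4 4)"
proof (rule ccontr)
  assume contr: "\<not> ?thesis"
  \<comment> \<open>An equality between two sums of two of the matrices is the second alternative;
    up to symmetry there are three of them.\<close>
  have "\<not> same_sum a b c d" if "{a, b, c, d} = {\<pi>1, \<pi>2, \<pi>3, \<pi>4}" for a b c d
    using contr perm_matrix_eq_if_same_sum[of a b c d] that by blast
  then have no_sum: "\<not> same_sum \<pi>1 \<pi>2 \<pi>3 \<pi>4" "\<not> same_sum \<pi>1 \<pi>3 \<pi>2 \<pi>4" "\<not> same_sum \<pi>1 \<pi>4 \<pi>2 \<pi>3"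
    by (simp_all add: insert_commute)
  define q :: "4 \<Rightarrow> nat \<Rightarrow> nat" where
    "q = (\<lambda>k. if k = 1 then \<pi>1 else if k = 2 then \<pi>2 else if k = 3 then \<pi>3 else \<pi>4)"
  have q: "q 1 = \<pi>1" "q 2 = \<pi>2" "q 3 = \<pi>3" "q 4 = \<pi>4" by (simp_all add: q_def)
  obtain Z \<tau> where \<tau>: "\<tau> permutes {1..4}" "perm_pairing \<tau> Z \<noteq> 0" "\<And>k. perm_pairing (q k) Z = 0"
    using ex_separating_direction[of q] by blast
  \<comment> \<open>The five permutations are indexed by \<open>4 option\<close>:
    \<open>None\<close> stands for the auxiliary \<open>\<tau>\<close>, \<open>Some\<close> for the
    given four.\<close>
  define p where "p = case_option \<tau> q"
  have p: "p k permutes {1..4}" for k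
    using assms(1-4) \<tau>(1) by (auto simp: p_def q_def split: option.split)
  have sum_option: "(\<Sum>k\<in>UNIV. g k) = g None + (\<Sum>k\<in>UNIV. g (Some k))" for g :: "4 option \<Rightarrow> real"
    by (simp add: UNIV_option_conv sum.reindex)
  have indep: "c k = 0" if comb: "\<And>i j. i \<in> {1..4} \<Longrightarrow> j \<in> {1..4} \<Longrightarrow>
      (\<Sum>k\<in>UNIV. c k * of_bool (p k i = j)) = e" for c :: "4 option \<Rightarrow> real" and e k
  proof -
    \<comment> \<open>Pairing the relation with \<open>Z\<close> kills the four given permutations
      by the choice of \<open>Z\<close> and the constant \<open>e\<close> by the zero row sums. Only
      \<open>c None\<close> survives, with a nonzero factor.\<close>
    have "(\<Sum>k\<in>UNIV. c k * perm_pairing (p k) Z) = (\<Sum>i\<in>{1..4}. \<Sum>j\<in>{1..4}. e * zero_sum Z i j)"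
      unfolding linear_combination_perm_pairing[OF p] by (intro sum.cong refl) (simp only: comb)
    also have "\<dots> = 0" by (simp only: sum_zero_sum_row flip: sum_distrib_left) simp
    finally have None: "c None = 0" using \<tau> by (simp add: sum_option p_def)
    have four: "c (Some 1) * of_bool (\<pi>1 i = j) + c (Some 2) * of_bool (\<pi>2 i = j) +
        c (Some 3) * of_bool (\<pi>3 i = j) + c (Some 4) * of_bool (\<pi>4 i = j) = e"
      if "i \<in> {1..4}" "j \<in> {1..4}" for i j
      using comb[OF that] by (simp only: sum_option sum_4 None) (simp add: p_def q)
    \<comment> \<open>A nonzero constant would make the four matrices add up to the all-one matrix;
      a nontrivial relation with constant zero would give two equal sums of two matrices.\<close>
    have "e = 0"
    proof (rule ccontr)
      assume "e \<noteq> 0"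
      have "perm_matrix 4 \<pi>1 + perm_matrix 4 \<pi>2 + perm_matrix 4 \<pi>3 + perm_matrix 4 \<pi>4 = all_one_matrix 4"
        by (rule perm_matrix_sum_all_one, rule four_permutations_cover[OF assms(1-4) four \<open>e \<noteq> 0\<close>])
      with contr show False by blast
    qed
    have "c (Some 1) = 0 \<and> c (Some 2) = 0 \<and> c (Some 3) = 0 \<and> c (Some 4) = 0"
    proof (rule ccontr)
      assume "\<not> ?thesis"
      from vanishing_combination_of_four[OF assms(1-5) four[unfolded \<open>e = 0\<close>] this] no_sum
      show False by blast
    qed
    then have "c (Some k) = 0" for k using exhaust_4[of k] by auto
    with None show "c k = 0" by (cases k) auto
  qed
  obtain H :: "real^(4 option) \<Rightarrow> real^3^3" where H: "linear H" "\<And>s k. perm_pairing (p k) (H s) = vec_nth s k"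
  proof -
    have "\<exists>H::real^(4 option) \<Rightarrow> real^3^3. linear H \<and> (\<forall>s k. perm_pairing (p k) (H s) = vec_nth s k)"
      by (rule perm_pairing_right_inverse) (fact p, rule indep, assumption)
    then show thesis using that by blast
  qed
  obtain \<rho> where \<rho>: "\<rho> > 0" "\<And>y :: real^(4 option). norm y \<le> \<rho> \<Longrightarrow>
      \<exists>N \<pi>. (\<forall>n. \<pi> n permutes {1..N n}) \<and> filterlim N at_top sequentially \<and>
        (\<forall>k. (\<lambda>n. pattern_density 4 (p k) (N n) (\<pi> n)) \<longlonglongrightarrow> (1 + vec_nth y k) / 24)"
    using ex_permutation_sequence[OF p H] by blast
  \<comment> \<open>This target leaves the four given densities at 1/24 and multiplies that of
    \<open>\<tau>\<close> by \<open>1 + \<rho>\<close>.\<close>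
  define y :: "real^(4 option)" where "y = \<rho> *\<^sub>R axis None 1"
  have "norm y \<le> \<rho>" using \<rho>(1) by (simp add: y_def norm_axis_1)
  from \<rho>(2)[OF this] obtain N \<pi> where N: "\<And>n. \<pi> n permutes {1..N n}" "filterlim N at_top sequentially"
    and lim: "\<And>k. (\<lambda>n. pattern_density 4 (p k) (N n) (\<pi> n)) \<longlonglongrightarrow> (1 + vec_nth y k) / 24" by blast
  have "(\<lambda>n. pattern_density 4 (q k) (N n) (\<pi> n)) \<longlonglongrightarrow> 1 / fact 4" for k
    using lim[of "Some k"] by (simp add: p_def y_def axis_def fact_numeral)
  from this[of 1] this[of 2] this[of 3] this[of 4]
  have "\<forall>(k, \<sigma>)\<in>{(4, \<pi>1), (4, \<pi>2), (4, \<pi>3), (4, \<pi>4)}.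
      (\<lambda>n. pattern_density k \<sigma> (N n) (\<pi> n)) \<longlonglongrightarrow> 1 / fact k"
    by (simp add: q)
  then have "(\<lambda>n. pattern_density 4 \<tau> (N n) (\<pi> n)) \<longlonglongrightarrow> 1 / fact 4"
    using assms(6) N \<tau>(1) unfolding quasirandom_forcing_def by blast
  moreover have "(\<lambda>n. pattern_density 4 \<tau> (N n) (\<pi> n)) \<longlonglongrightarrow> (1 + \<rho>) / 24"
    using lim[of None] by (simp add: p_def y_def axis_def)
  ultimately have "1 / fact 4 = (1 + \<rho>) / 24" by (rule LIMSEQ_unique)
  then show False using \<rho>(1) by (simp add: fact_numeral)
qed

end
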